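(* Let $n\in\mathbb{N}$ ($n\ge1$), $r\in\mathcal{D}_n$ and $M\subset\mathcal{M}_n^r=(\mathcal{P}_{2n}\times(0,\infty))/\Pi_r$. Assume that there are positive constants $C_0,C_1,C_2>0$ and a compact interval $I\subset(0,\infty)$ such that $g\in I$, $m_r(h)\geq C_0$, $\det(h)\leq C_1$ and $d_n(h)\leq C_2$ for all $[(h,g)]\in M$. Then $M$ has compact closure in $\mathcal{M}_n^r$.
   Context: $\mathcal{P}_{k}$ denotes the space of real symmetric positive definite $k\times k$ matrices. $\mathrm{GL}(k;\mathbb{R})$ acts on $\mathcal{P}_k$ from the right by $Y[G]:={}^{t}G\,Y\,G$; also write $Y[a]:={}^{t}a\,Y\,a$ for $a\in\mathbb{R}^k$. $J=\begin{pmatrix}0&\mathrm{Id}_n\\-\mathrm{Id}_n&0\end{pmatrix}$ and $\widetilde{\mathrm{Sp}}(2n;\mathbb{R}):=\{\beta\in\mathrm{GL}(2n;\mathbb{R}) : {}^{t}\beta J\beta=\epsilon(\beta)J,\ \epsilon(\beta)\in\{1,-1\}\}$. $\mathcal{D}_n$ is the set of $n$-tuples $r=(r_1,\dots,r_n)$ of positive integers with $r_i\mid r_{i+1}$ for $1\le i\le n-1$. For $r\in\mathcal{D}_n$ put $\delta_r:=\mathrm{diag}(r_1,\dots,r_n,1,\dots,1)$ (a $2n\times 2n$ matrix), $G_r:=\delta_r\,\mathrm{GL}(2n;\mathbb{Z})\,\delta_r^{-1}$ and $\Pi_r:=G_r\cap\widetilde{\mathrm{Sp}}(2n;\mathbb{R})$.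 $\mathcal{M}_n^r:=(\mathcal{P}_{2n}\times(0,\infty))/\Pi_r$ is the orbit space, with the quotient topology, of the right action of $\Pi_r$ given by $(h,g)\cdot\beta=(h[\beta],g)$; $[(h,g)]$ is the class of $(h,g)$. (It is the moduli space of isometry classes of left invariant metrics on the compact Heisenberg manifold associated with $r$.) For $h\in\mathcal{P}_{2n}$: $m_r(h):=\inf\{h[\delta_r a] : a\in\mathbb{Z}^{2n}\setminus\{0\}\}$. The matrix $h^{-1}J$ has purely imaginary nonzero eigenvalues in complex conjugate pairs; $0<d_1(h)\le\dots\le d_n(h)$ are defined so that $\pm i\,d_k(h)$, $k=1,\dots,n$, are the eigenvalues of $h^{-1}J$ (with multiplicity). The functions $m_r$, $\det$ and $d_n$ are invariant under $\Pi_r$, so the conditions do not depend on the representative $(h,g)$. *)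

theory Defs
  imports "HOL-Analysis.Analysis" "HOL-Computational_Algebra.Polynomial"
begin

text \<open>
  The type \<open>'n\<close>, finite and linearly ordered, stands for the index set \<open>{1..n}\<close>; every \<open>n \<ge> 1\<close>
  arises as the cardinality of such a type. The index type of \<open>2n \<times> 2n\<close> matrices is \<open>'n + 'n\<close>:
  \<open>Inl\<close> gives the first \<open>n\<close> indices and \<open>Inr\<close> the last \<open>n\<close>.
\<close>

definition pos_def :: "(real^'m^'m) set" where
  "pos_def = {Y. transpose Y = Y \<and> (\<forall>x. x \<noteq> 0 \<longrightarrow> 0 < x \<bullet> (Y *v x))}"

definition mat_act :: "real^'m^'m \<Rightarrow> real^'m^'m \<Rightarrow> real^'m^'m" where
  "mat_act Y G = transpose G ** Y ** G"

definition qform :: "real^'m^'m \<Rightarrow> real^'m \<Rightarrow> real" where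
  "qform Y a = a \<bullet> (Y *v a)"

definition symp_J :: "real^('n::finite + 'n)^('n + 'n)" where
  "symp_J = (\<chi> i j. case (i, j) of
       (Inl a, Inr b) \<Rightarrow> if a = b then 1 else 0
     | (Inr a, Inl b) \<Rightarrow> if a = b then - 1 else 0
     | _ \<Rightarrow> 0)"

definition Sp_tilde :: "(real^('n::finite + 'n)^('n + 'n)) set" where
  "Sp_tilde = {\<beta>. invertible \<beta> \<and> (\<exists>\<epsilon>\<in>{1, - 1}. transpose \<beta> ** symp_J ** \<beta> = \<epsilon> *\<^sub>R symp_J)}"

text \<open>
  The condition \<open>{i<..<j} = {}\<close> says that \<open>j\<close> is the successor of \<open>i\<close>.
\<close>

definition div_chains :: "('n::{finite,linorder} \<Rightarrow> nat) set" where
  "div_chains = {r. (\<forall>i. 0 < r i) \<and> (\<forall>i j. i < j \<and> {i<..<j} = {} \<longrightarrow> r i dvd r j)}"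

definition delta :: "('n::finite \<Rightarrow> nat) \<Rightarrow> real^('n + 'n)^('n + 'n)" where
  "delta r = (\<chi> i j. if i = j then (case i of Inl a \<Rightarrow> real (r a) | Inr a \<Rightarrow> 1) else 0)"

text \<open>
  \<open>invertible A\<close> for an integer matrix \<open>A\<close> means that \<open>A\<close> has an integer inverse, that is,
  \<open>A \<in> GL(2n; \<int>)\<close>.
\<close>

definition G_grp :: "('n::finite \<Rightarrow> nat) \<Rightarrow> (real^('n + 'n)^('n + 'n)) set" where
  "G_grp r = {delta r ** map_matrix real_of_int A ** matrix_inv (delta r) | A. invertible A}"

definition Pi_grp :: "('n::finite \<Rightarrow> nat) \<Rightarrow> (real^('n + 'n)^('n + 'n)) set" where
  "Pi_grp r = G_grp r \<inter> Sp_tilde"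

definition metric_params :: "((real^('n::finite + 'n)^('n + 'n)) \<times> real) set" where
  "metric_params = pos_def \<times> {0<..}"

definition metric_class ::
  "('n::finite \<Rightarrow> nat) \<Rightarrow> (real^('n + 'n)^('n + 'n)) \<times> real
     \<Rightarrow> ((real^('n + 'n)^('n + 'n)) \<times> real) set" where
  "metric_class r = (\<lambda>(h, g). {(mat_act h \<beta>, g) | \<beta>. \<beta> \<in> Pi_grp r})"

definition moduli_space ::
  "('n::finite \<Rightarrow> nat) \<Rightarrow> ((real^('n + 'n)^('n + 'n)) \<times> real) set topology" where
  "moduli_space r = topology (\<lambda>U. U \<subseteq> metric_class r ` metric_params \<and>
     openin (top_of_set metric_params) {x \<in> metric_params. metric_class r x \<in> U})"

lemma openin_moduli_space:
  "openin (moduli_space r) U \<longleftrightarrow> U \<subseteq> metric_class r ` metric_params \<and>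
     openin (top_of_set metric_params) {x \<in> metric_params. metric_class r x \<in> U}"
proof -
  have "istopology (\<lambda>U. U \<subseteq> metric_class r ` metric_params \<and>
     openin (top_of_set metric_params) {x \<in> metric_params. metric_class r x \<in> U})"
    (is "istopology ?L")
    unfolding istopology_def
  proof (intro conjI allI impI)
    fix S T assume S: "?L S" and T: "?L T"
    show "S \<inter> T \<subseteq> metric_class r ` metric_params" using S by blast
    have "{x \<in> metric_params. metric_class r x \<in> S \<inter> T}
        = {x \<in> metric_params. metric_class r x \<in> S} \<inter> {x \<in> metric_params. metric_class r x \<in> T}"
      by blast
    with S T show "openin (top_of_set metric_params) {x \<in> metric_params. metric_class r x \<in> S \<inter> T}"
      by (metis (no_types, lifting) openin_Int)
  next
    fix K assume K: "\<forall>S\<in>K. ?L S"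
    show "\<Union>K \<subseteq> metric_class r ` metric_params" using K by blast
    have "{x \<in> metric_params. metric_class r x \<in> \<Union>K}
        = (\<Union>S\<in>K. {x \<in> metric_params. metric_class r x \<in> S})" by blast
    with K show "openin (top_of_set metric_params) {x \<in> metric_params. metric_class r x \<in> \<Union>K}"
      by (metis (no_types, lifting) openin_Union image_iff)
  qed
  thus ?thesis by (simp add: moduli_space_def)
qed

lemma topspace_moduli_space: "topspace (moduli_space r) = metric_class r ` metric_params"
proof (rule antisym)
  show "topspace (moduli_space r) \<subseteq> metric_class r ` metric_params"
    by (simp add: topspace_def openin_moduli_space Sup_le_iff)
  have "{x \<in> metric_params. metric_class r x \<in> metric_class r ` metric_params} = metric_params"
    by blast
  hence "openin (moduli_space r) (metric_class r ` metric_params)"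
    by (simp add: openin_moduli_space)
  thus "metric_class r ` metric_params \<subseteq> topspace (moduli_space r)"
    by (rule openin_subset)
qed

lemma quotient_map_moduli_space:
  "quotient_map (top_of_set metric_params) (moduli_space r) (metric_class r)"
  unfolding quotient_map_def by (simp add: topspace_moduli_space openin_moduli_space)

definition m_min :: "('n::finite \<Rightarrow> nat) \<Rightarrow> real^('n + 'n)^('n + 'n) \<Rightarrow> real" where
  "m_min r h = Inf {qform h (delta r *v (\<chi> i. real_of_int (a $ i))) | a. a \<noteq> 0}"

definition charpoly :: "complex^'m^'m \<Rightarrow> complex poly" where
  "charpoly A = det (\<chi> i j. (if i = j then [:0, 1:] else 0) - [:A $ i $ j:])"

text \<open>
  \<open>symp_eig h k\<close> is \<open>d\<^sub>k(h)\<close>. The factorisation of the characteristic polynomial says that the numbers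
  \<open>\<i> * d k\<close> and \<open>- \<i> * d k\<close> are the eigenvalues of \<open>h\<^sup>-\<^sup>1 J\<close>, counted with algebraic multiplicity.
  For \<open>h\<close> positive definite exactly one tuple \<open>d\<close> satisfies the description.
\<close>

definition symp_eig :: "real^('n::{finite,linorder} + 'n)^('n + 'n) \<Rightarrow> 'n \<Rightarrow> real" where
  "symp_eig h = (THE d. (\<forall>k. 0 < d k) \<and> mono d \<and>
     charpoly (map_matrix complex_of_real (matrix_inv h ** symp_J)) =
       (\<Prod>k\<in>UNIV. [:- (\<i> * complex_of_real (d k)), 1:] * [:\<i> * complex_of_real (d k), 1:]))"

definition max_symp_eig :: "real^('n::{finite,linorder} + 'n)^('n + 'n) \<Rightarrow> real" where
  "max_symp_eig h = symp_eig h (Max UNIV)"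

end

theory Submission
  imports Defs "HOL-Computational_Algebra.Fundamental_Theorem_Algebra"
begin

text \<open>
  Two facts imply the theorem. Every class in \<open>M\<close> has a representative in one fixed compact subset of
  \<open>\<P>\<^sub>2\<^sub>n \<times> (0, \<infinity>)\<close>, and the image of a compact subset in the moduli space is closed as well as
  compact. Hence the closure of \<open>M\<close> is a closed subset of a compact set.

  For the representatives (\<open>compact_representatives\<close>), consider first the larger group \<open>G\<^sub>r\<close> in place of
  \<open>\<Pi>\<^sub>r\<close>. The bounds on \<open>m\<^sub>r(h)\<close> and \<open>det h\<close> say that the form \<open>h[\<delta>\<^sub>r]\<close> has no short integer vectors and
  has bounded determinant. By Hermite's reduction theory (\<open>hermite_reduction\<close>) some \<open>A \<in> GL(2n, \<int>)\<close> then carries it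
  into a compact set of positive definite forms.

  The bound on \<open>d\<^sub>n(h)\<close> serves to pass from \<open>G\<^sub>r\<close> to \<open>\<Pi>\<^sub>r\<close>. The number \<open>d\<^sub>n(h)\<close> is the norm of the
  symplectic form with respect to the inner product \<open>h\<close> (\<open>symplectic_form_bound\<close> is the inequality needed). On a basis of
  bounded \<open>h\<close>-length the symplectic form therefore has bounded entries; for the basis given by the columns of
  \<open>P = \<delta>\<^sub>r A\<close> these are integers. So only finitely many matrices \<open>P\<^sup>T J P\<close> occur. Two matrices \<open>P\<close> with
  the same \<open>P\<^sup>T J P\<close> differ by an element of \<open>\<Pi>\<^sub>r\<close>, which means that \<open>A\<close> can be corrected to an element
  of \<open>\<Pi>\<^sub>r\<close> at the price of finitely many compact sets instead of one.

  Images of compact sets are closed (\<open>closedin_image_compact\<close>) because the discrete group \<open>\<Pi>\<^sub>r\<close> acts properly: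
  an element that carries a form near \<open>h\<close> to a bounded form has bounded entries.
\<close>

section \<open>Quadratic forms and changes of basis\<close>

lemma mat_act_mult: "mat_act (mat_act Y G) H = mat_act Y (G ** H)"
  by (simp add: mat_act_def matrix_transpose_mul matrix_mul_assoc)

lemma mat_act_one [simp]: "mat_act Y (mat 1) = Y"
  by (simp add: mat_act_def transpose_mat)

lemma bilinear_mat_act: "x \<bullet> (mat_act Y G *v y) = (G *v x) \<bullet> (Y *v (G *v y))"
  unfolding mat_act_def
  by (simp add: dot_lmul_matrix flip: matrix_vector_mul_assoc)
    (metis dot_lmul_matrix transpose_matrix_vector transpose_transpose)

lemma qform_mat_act: "qform (mat_act Y G) x = qform Y (G *v x)"
  by (simp add: qform_def bilinear_mat_act)

lemma bilinear_axis: "axis i 1 \<bullet> ((Y::real^'m^'m) *v axis j 1) = Y $ i $ j"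
  by (simp add: matrix_vector_mul_component inner_axis inner_axis' flip: column_def)

lemma qform_axis: "qform Y (axis i 1) = Y $ i $ i"
  by (simp add: qform_def bilinear_axis)

lemma sym_bilinear:
  assumes "transpose (Y::real^'m^'m) = Y" shows "x \<bullet> (Y *v y) = y \<bullet> (Y *v x)"
  using assms by (metis dot_lmul_matrix inner_commute transpose_matrix_vector)

lemma qform_add:
  assumes "transpose (Y::real^'m^'m) = Y"
  shows "qform Y (x + y) = qform Y x + 2 * (x \<bullet> (Y *v y)) + qform Y y"
  using sym_bilinear[OF assms, of x y]
  by (simp add: qform_def matrix_vector_right_distrib inner_add_left inner_add_right)

lemma qform_scale: "qform Y (t *\<^sub>R x) = t\<^sup>2 * qform Y x"
  by (simp add: qform_def matrix_vector_mult_scaleR power2_eq_square)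

lemma pos_defD:
  assumes "Y \<in> pos_def"
  shows "transpose Y = Y" "x \<noteq> 0 \<Longrightarrow> 0 < qform Y x" "0 \<le> qform Y x"
  using assms by (auto simp: pos_def_def qform_def) (metis inner_zero_left less_eq_real_def)

lemma transpose_mat_act: "transpose Y = Y \<Longrightarrow> transpose (mat_act Y G) = mat_act Y G"
  by (simp add: mat_act_def matrix_transpose_mul matrix_mul_assoc)

lemma invertible_mult_vec_nonzero:
  assumes "invertible (G::real^'m^'m)" "x \<noteq> 0" shows "G *v x \<noteq> 0"
  using assms by (metis invertible_def matrix_left_invertible_ker)

lemma mat_act_pos_def:
  assumes "Y \<in> pos_def" "invertible G" shows "mat_act Y G \<in> pos_def"
proof -
  have "0 < qform (mat_act Y G) x" if "x \<noteq> 0" for x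
    using that assms by (simp add: qform_mat_act pos_defD invertible_mult_vec_nonzero)
  then show ?thesis
    using assms by (simp add: pos_def_def transpose_mat_act qform_def)
qed

lemma det_mat_act: "det (mat_act Y G) = (det G)\<^sup>2 * det Y"
  by (simp add: mat_act_def det_mul det_transpose power2_eq_square)

lemma matrix_inv_cancel:
  assumes "invertible (G::real^'m^'m)"
  shows "G ** matrix_inv G = mat 1" "matrix_inv G ** G = mat 1"
    "A ** G ** matrix_inv G = A" "A ** matrix_inv G ** G = A"
    "invertible (matrix_inv G)"
proof -
  have *: "G ** matrix_inv G = mat 1 \<and> matrix_inv G ** G = mat 1"
    using assms unfolding invertible_def matrix_inv_def by (rule someI_ex)
  then show "G ** matrix_inv G = mat 1" "matrix_inv G ** G = mat 1"
    "A ** G ** matrix_inv G = A" "A ** matrix_inv G ** G = A"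
    by (simp_all flip: matrix_mul_assoc)
  show "invertible (matrix_inv G)"
    using * by (auto simp: invertible_def)
qed

section \<open>Integral matrices\<close>

text \<open>
  Integrality is a property of real matrices here, so that members of \<open>GL(m, \<int>)\<close> can be multiplied with
  real forms without coercions.
\<close>

definition int_mat :: "(real^'m^'n) set" where
  "int_mat = {A. \<forall>i j. A $ i $ j \<in> \<int>}"

definition int_GL :: "(real^'m^'m) set" where
  "int_GL = {A \<in> int_mat. \<exists>B\<in>int_mat. A ** B = mat 1 \<and> B ** A = mat 1}"

lemma map_of_int_mult:
  "map_matrix real_of_int (A ** B) = map_matrix real_of_int A ** map_matrix real_of_int B"
  by (simp add: vec_eq_iff matrix_matrix_mult_def map_matrix_def)

lemma int_mat_eq: "int_mat = range (map_matrix real_of_int)"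
proof (intro equalityI subsetI)
  fix A :: "real^'a^'b" assume "A \<in> int_mat"
  then have "A = map_matrix real_of_int (\<chi> i j. \<lfloor>A $ i $ j\<rfloor>)"
    by (auto simp: vec_eq_iff int_mat_def map_matrix_def)
  then show "A \<in> range (map_matrix real_of_int)" by blast
qed (auto simp: int_mat_def map_matrix_def)

lemma int_GL_eq: "int_GL = {map_matrix real_of_int A | A. invertible A}"
proof -
  have *: "map_matrix real_of_int A ** map_matrix real_of_int B = mat 1 \<longleftrightarrow> A ** B = mat 1"
    for A B :: "int^'a^'a"
    unfolding map_of_int_mult[symmetric] by (simp add: vec_eq_iff mat_def map_matrix_def)
  show ?thesis
    unfolding int_GL_def int_mat_eq invertible_def using * by (auto 0 4)
qed

lemma int_mat_mult: "A \<in> int_mat \<Longrightarrow> B \<in> int_mat \<Longrightarrow> A ** B \<in> int_mat"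
  by (auto simp: int_mat_def matrix_matrix_mult_def intro!: Ints_sum Ints_mult)

lemma int_GL_mult:
  assumes "A \<in> int_GL" "B \<in> int_GL" shows "A ** B \<in> int_GL"
proof -
  obtain A' B' where "A' \<in> int_mat" "A ** A' = mat 1" "A' ** A = mat 1"
     "B' \<in> int_mat" "B ** B' = mat 1" "B' ** B = mat 1"
    using assms by (auto simp: int_GL_def)
  then have "A ** B ** (B' ** A') = mat 1" "B' ** A' ** (A ** B) = mat 1"
    by (metis matrix_mul_assoc matrix_mul_rid)+
  then show ?thesis
    using assms \<open>A' \<in> int_mat\<close> \<open>B' \<in> int_mat\<close> int_mat_mult by (auto simp: int_GL_def)
qed

lemma int_GL_invertible: "A \<in> int_GL \<Longrightarrow> invertible A"
  by (auto simp: int_GL_def invertible_def)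

lemma int_GL_inverse: "A \<in> int_GL \<Longrightarrow> matrix_inv A \<in> int_GL"
proof -
  assume A: "A \<in> int_GL"
  then obtain B where B: "B \<in> int_mat" "A ** B = mat 1" "B ** A = mat 1"
    by (auto simp: int_GL_def)
  then have "matrix_inv A = B"
    using matrix_inv_cancel(4)[OF int_GL_invertible[OF A], of B]
      matrix_inv_cancel(2)[OF int_GL_invertible[OF A]]
      matrix_inv_cancel(3)[OF int_GL_invertible[OF A], of B] by simp
  then show ?thesis using A B by (auto simp: int_GL_def)
qed

lemma int_mat_one: "mat 1 \<in> int_mat"
  by (simp add: int_mat_def mat_def)

lemma int_GL_one: "mat 1 \<in> int_GL"
  using int_mat_one by (force simp: int_GL_def)

lemma det_int_GL: assumes "A \<in> int_GL" shows "(det A)\<^sup>2 = 1"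
proof -
  obtain B where B: "A \<in> int_mat" "B \<in> int_mat" "A ** B = mat 1"
    using assms by (auto simp: int_GL_def)
  have int: "det X \<in> \<int>" if "X \<in> int_mat" for X :: "real^'a^'a"
    using that unfolding det_def int_mat_def by (auto intro!: Ints_sum Ints_mult Ints_prod)
  obtain a b where ab: "det A = of_int a" "det B = of_int b"
    using int B by (metis Ints_cases)
  have "det A * det B = 1" using B(3) by (metis det_I det_mul)
  then have "a * b = 1" unfolding ab by (metis of_int_eq_1_iff of_int_mult)
  then have "a = 1 \<or> a = -1" using zmult_eq_1_iff by blast
  then show ?thesis using ab by auto
qed

text \<open>
  This discreteness is used twice: for the transformed symplectic forms, and for the elements of
  \<open>\<Pi>\<^sub>r\<close> that move a point close to a compact set back into it.
\<close>

lemma finite_bounded_int_mat: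
  "finite {A :: real^'m^'n. A \<in> int_mat \<and> (\<forall>i j. \<bar>A $ i $ j\<bar> \<le> N)}"
proof (rule finite_subset)
  let ?F = "{f :: ('n \<times> 'm) \<Rightarrow> int. \<forall>p. f p \<in> {-\<lceil>N\<rceil>..\<lceil>N\<rceil>}}"
  have "?F = (\<Pi>\<^sub>E p\<in>UNIV. {-\<lceil>N\<rceil>..\<lceil>N\<rceil>})" by (auto simp: PiE_def)
  then show "finite ((\<lambda>f. \<chi> i j. real_of_int (f (i, j))) ` ?F)"
    by (simp only:) (intro finite_imageI finite_PiE; simp)
  show "{A :: real^'m^'n. A \<in> int_mat \<and> (\<forall>i j. \<bar>A $ i $ j\<bar> \<le> N)}
    \<subseteq> (\<lambda>f. \<chi> i j. real_of_int (f (i, j))) ` ?F"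
  proof
    fix A :: "real^'m^'n" assume A: "A \<in> {A. A \<in> int_mat \<and> (\<forall>i j. \<bar>A $ i $ j\<bar> \<le> N)}"
    define f where "f = (\<lambda>(i,j). \<lfloor>A $ i $ j\<rfloor>)"
    have fA: "real_of_int (f (i, j)) = A $ i $ j" for i j
      using A by (auto simp: f_def int_mat_def)
    have "\<bar>real_of_int (f (i, j))\<bar> \<le> N" for i j using A unfolding fA by blast
    then have "f \<in> ?F" by (auto simp: abs_le_iff) (smt (verit) le_of_int_ceiling of_int_le_iff of_int_minus)+
    moreover have "A = (\<chi> i j. real_of_int (f (i, j)))" using fA by (simp add: vec_eq_iff)
    ultimately show "A \<in> (\<lambda>f. \<chi> i j. real_of_int (f (i, j))) ` ?F" by blast
  qed
qed

section \<open>Completing squares\<close>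

text \<open>
  The matrix \<open>1 + e\<^sub>i v\<^sup>T\<close>. With \<open>v\<close> real it completes a square at the index \<open>i\<close>; with \<open>v\<close> integral it
  adds multiples of the basis vector \<open>e\<^sub>i\<close> to the other basis vectors.
\<close>

definition shear :: "'m \<Rightarrow> real^'m \<Rightarrow> real^'m^'m" where
  "shear i v = (\<chi> k l. (if k = l then 1 else 0) + (if k = i then v $ l else 0))"

lemma shear_mult_vec: "shear i v *v z = z + (v \<bullet> z) *\<^sub>R axis i 1"
proof -
  have "(shear i v *v z) $ k = (z + (v \<bullet> z) *\<^sub>R axis i 1) $ k" for k
    by (cases "k = i")
      (simp_all add: shear_def matrix_vector_mult_def axis_def inner_vec_def algebra_simps
        sum.distrib if_distrib[of "\<lambda>x. _ * x"] cong: if_cong)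
  then show ?thesis by (simp add: vec_eq_iff)
qed

text \<open>
  As \<open>v\<^sub>i = 0\<close>, the matrix \<open>e\<^sub>i v\<^sup>T\<close> has square zero.
\<close>

lemma shear_inverse:
  assumes "v $ i = 0" shows "shear i v ** shear i (- v) = mat 1"
proof -
  have "shear i v *v (shear i (- v) *v z) = z" for z
    using assms by (simp add: shear_mult_vec inner_add_right inner_diff_right inner_axis)
  then show ?thesis
    by (metis (no_types) matrix_eq matrix_vector_mul_assoc matrix_vector_mul_lid)
qed

lemma invertible_shear: "v $ i = 0 \<Longrightarrow> invertible (shear i v)"
  using shear_inverse by (auto simp: invertible_right_inverse)

lemma row_mat_one: "row j (mat 1) = axis j 1"
  by (auto simp: vec_eq_iff row_def mat_def axis_def)

lemma det_shear:
  assumes "v $ i = 0" shows "det (shear i v) = 1"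
proof -
  have "v = (\<Sum>j\<in>UNIV. v $ j *s axis j 1)"
    by (simp add: basis_expansion)
  also have "\<dots> = (\<Sum>j\<in>UNIV - {i}. v $ j *s row j (mat 1))"
    using assms by (subst sum.remove[of _ i]) (simp_all add: row_mat_one)
  also have "\<dots> \<in> vec.span {row j (mat 1) |j. j \<noteq> i}"
    by (intro vec.span_sum vec.span_scale vec.span_base) auto
  finally have "det (\<chi> k. if k = i then row i (mat 1) + v else row k (mat 1)) = det (mat 1 :: real^'a^'a)"
    by (rule det_row_span)
  moreover have "(\<chi> k. if k = i then row i (mat 1) + v else row k (mat 1)) = shear i v"
    by (auto simp: vec_eq_iff shear_def row_def mat_def)
  ultimately show ?thesis by simp
qed

lemma shear_int_GL:
  assumes "v $ i = 0" "\<And>j. v $ j \<in> \<int>" shows "shear i v \<in> int_GL"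
proof -
  have *: "shear i v \<in> int_mat" if "\<And>j. v $ j \<in> \<int>" for v
    using that by (auto simp: int_mat_def shear_def)
  have "shear i v ** shear i (- v) = mat 1" "shear i (- v) ** shear i v = mat 1"
    using assms shear_inverse[of v i] shear_inverse[of "- v" i] by simp_all
  then show ?thesis using assms * by (auto simp: int_GL_def intro!: bexI[of _ "shear i (- v)"])
qed

text \<open>
  Completing the square at \<open>i\<close>: \<open>Y[x] = Y\<^sub>i\<^sub>i (x\<^sub>i + \<Sum>\<^sub>j\<^sub>\<noteq>\<^sub>i \<mu>\<^sub>j x\<^sub>j)\<^sup>2 + W[x]\<close>, where \<open>W\<close> does not involve
  \<open>x\<^sub>i\<close>. The vector \<open>\<mu>\<close> is \<open>slope Y i\<close>, and \<open>split_form Y i\<close> is the form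
  \<open>Y\<^sub>i\<^sub>i x\<^sub>i\<^sup>2 + W[x]\<close>, so that the index \<open>i\<close> is orthogonal to all the others.
\<close>

definition split_form :: "real^'m^'m \<Rightarrow> 'm \<Rightarrow> real^'m^'m" where
  "split_form Y i = (\<chi> j k. if j = i \<and> k = i then Y $ i $ i
      else Y $ j $ k - Y $ i $ j * Y $ i $ k / Y $ i $ i)"

definition slope :: "real^'m^'m \<Rightarrow> 'm \<Rightarrow> real^'m" where
  "slope Y i = (\<chi> j. if j = i then 0 else Y $ i $ j / Y $ i $ i)"

lemma slope_self [simp]: "slope Y i $ i = 0"
  by (simp add: slope_def)

lemma symmetric_entries: "transpose Y = Y \<Longrightarrow> Y $ j $ k = Y $ k $ j"
  by (metis transpose_def vec_lambda_beta)

lemma complete_square: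
  assumes sym: "transpose Y = Y" and "Y $ i $ i \<noteq> 0"
  shows "mat_act (split_form Y i) (shear i (slope Y i)) = Y"
proof -
  let ?W = "split_form Y i" and ?V = "shear i (slope Y i)"
  have "mat_act ?W ?V $ j $ k = Y $ j $ k" for j k
  proof -
    have "mat_act ?W ?V $ j $ k = (axis j 1 + slope Y i $ j *\<^sub>R axis i 1) \<bullet>
        (?W *v (axis k 1 + slope Y i $ k *\<^sub>R axis i 1))"
      by (simp add: bilinear_axis[symmetric] bilinear_mat_act shear_mult_vec inner_axis)
    also have "\<dots> = ?W $ j $ k + slope Y i $ k * ?W $ j $ i
        + slope Y i $ j * (?W $ i $ k + slope Y i $ k * ?W $ i $ i)"
      by (simp add: matrix_vector_right_distrib inner_add_left inner_add_right
          matrix_vector_mult_scaleR bilinear_axis algebra_simps)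
    also have "\<dots> = Y $ j $ k"
      using assms(2) symmetric_entries[OF sym, of j i] by (auto simp: split_form_def slope_def)
    finally show ?thesis .
  qed
  then show ?thesis by (simp add: vec_eq_iff)
qed

lemma split_form_pos_def:
  assumes "Y \<in> pos_def" shows "split_form Y i \<in> pos_def" "det (split_form Y i) = det Y"
proof -
  have "Y $ i $ i > 0"
    using pos_defD(2)[OF assms, of "axis i 1"] by (simp add: qform_axis axis_eq_0_iff)
  then have eq: "mat_act (split_form Y i) (shear i (slope Y i)) = Y"
    using complete_square pos_defD(1)[OF assms] by (metis less_irrefl)
  let ?V = "shear i (slope Y i)"
  have V: "invertible ?V" by (simp add: invertible_shear)
  have "split_form Y i = mat_act Y (matrix_inv ?V)"
    by (metis eq mat_act_mult mat_act_one V matrix_inv_cancel(1))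
  then show "split_form Y i \<in> pos_def"
    using mat_act_pos_def[OF assms matrix_inv_cancel(5)[OF V]] by simp
  show "det (split_form Y i) = det Y"
    using eq det_mat_act[of "split_form Y i" ?V] det_shear[of "slope Y i" i] by simp
qed

lemma qform_split:
  assumes "transpose Y = Y" "Y $ i $ i \<noteq> 0" "u $ i = 0"
  shows "qform Y (u + x *\<^sub>R axis i 1)
     = qform (split_form Y i) u + (slope Y i \<bullet> u + x)\<^sup>2 * Y $ i $ i"
proof -
  let ?W = "split_form Y i"
  have "?W $ j $ k = ?W $ k $ j" for j k
    using symmetric_entries[OF assms(1), of j k] by (auto simp: split_form_def)
  then have W: "transpose ?W = ?W"
    by (simp add: transpose_def vec_eq_iff)
  have "?W $ j $ i = Y $ i $ i * axis i 1 $ j" for j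
    using assms(2) symmetric_entries[OF assms(1), of j i]
    by (cases "j = i") (simp_all add: split_form_def axis_def)
  then have Wi: "?W *v axis i 1 = Y $ i $ i *\<^sub>R axis i 1"
    by (simp add: vec_eq_iff matrix_vector_mul_component inner_axis)
  have "qform Y (u + x *\<^sub>R axis i 1) = qform ?W (shear i (slope Y i) *v (u + x *\<^sub>R axis i 1))"
    by (metis assms(1,2) complete_square qform_mat_act)
  also have "\<dots> = qform ?W (u + (slope Y i \<bullet> u + x) *\<^sub>R axis i 1)"
    by (simp add: shear_mult_vec inner_add_right inner_axis algebra_simps)
  also have "\<dots> = qform ?W u + (slope Y i \<bullet> u + x)\<^sup>2 * Y $ i $ i"
    by (simp add: qform_add[OF W] matrix_vector_mult_scaleR Wi inner_axis assms qform_scale qform_axis)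
      (simp add: split_form_def)
  finally show ?thesis .
qed

section \<open>Reduction of positive definite forms\<close>

text \<open>
  The induction below splits off one index at a time, while the matrices keep their size: the indices
  outside \<open>S\<close> have been split off already. \<open>GL_on S\<close> stands for \<open>GL(S, \<int>)\<close>, and
  \<open>block_on S\<close> consists of the matrices that are diagonal outside \<open>S \<times> S\<close>.
\<close>

definition GL_on :: "'m set \<Rightarrow> (real^'m^'m) set" where
  "GL_on S = {A \<in> int_GL. \<forall>k j. k \<notin> S \<or> j \<notin> S \<longrightarrow> A $ k $ j = (if k = j then 1 else 0)}"

definition block_on :: "'m set \<Rightarrow> (real^'m^'m) set" where
  "block_on S = {Y. \<forall>k j. k \<noteq> j \<and> (k \<notin> S \<or> j \<notin> S) \<longrightarrow> Y $ k $ j = 0}"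

lemma matrix_axis_component: "((A::real^'m^'n) *v axis j 1) $ i = A $ i $ j"
  by (simp add: matrix_vector_mul_component inner_axis)

lemma GL_on_one: "mat 1 \<in> GL_on S"
  using int_GL_one by (auto simp: GL_on_def mat_def)

lemma GL_on_mono: "S \<subseteq> T \<Longrightarrow> GL_on S \<subseteq> GL_on T"
  unfolding GL_on_def by blast

lemma GL_on_mult:
  assumes "A \<in> GL_on S" "B \<in> GL_on S" shows "A ** B \<in> GL_on S"
proof -
  have "(A ** B) $ k $ j = (if k = j then 1 else 0)" if "k \<notin> S \<or> j \<notin> S" for k j
    using that
  proof
    assume "k \<notin> S"
    then have "A $ k $ l = (if k = l then 1 else 0)" "B $ k $ j = (if k = j then 1 else 0)" for l
      using assms by (auto simp: GL_on_def)
    then show ?thesis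
      by (simp add: matrix_matrix_mult_def if_distrib[of "\<lambda>x. x * _"] cong: if_cong)
  next
    assume "j \<notin> S"
    then have "B $ l $ j = (if l = j then 1 else 0)" "A $ k $ j = (if k = j then 1 else 0)" for l
      using assms by (auto simp: GL_on_def)
    then show ?thesis
      by (simp add: matrix_matrix_mult_def if_distrib[of "\<lambda>x. _ * x"] cong: if_cong)
  qed
  then show ?thesis using assms int_GL_mult by (auto simp: GL_on_def)
qed

lemma GL_on_axis: "A \<in> GL_on S \<Longrightarrow> j \<notin> S \<Longrightarrow> A *v axis j 1 = axis j 1"
  by (simp add: vec_eq_iff matrix_axis_component GL_on_def) (simp add: axis_def)

lemma GL_on_axis_component:
  "A \<in> GL_on S \<Longrightarrow> i \<notin> S \<Longrightarrow> (A *v axis j 1) $ i = (if i = j then 1 else 0)"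
  by (simp add: matrix_axis_component GL_on_def)

lemma block_on_split_form:
  assumes "Y \<in> block_on S" "transpose Y = Y" "Y $ i $ i \<noteq> 0" 
  shows "split_form Y i \<in> block_on (S - {i})"
proof -
  have "split_form Y i $ k $ j = 0" if "k \<noteq> j" "k \<notin> S - {i} \<or> j \<notin> S - {i}" for k j
    using that assms(1,3) symmetric_entries[OF assms(2), of k i]
    by (cases "k = i"; cases "j = i") (auto simp: block_on_def split_form_def)
  then show ?thesis by (simp add: block_on_def)
qed

lemma block_on_mat_act:
  assumes "Y \<in> block_on S" "A \<in> GL_on S" shows "mat_act Y A \<in> block_on S"
proof -
  have *: "(mat_act Y A) $ k $ j = 0" if "k \<noteq> j" "k \<notin> S \<or> j \<notin> S" for k j
  proof -
    have Yj: "Y *v axis j 1 = Y $ j $ j *\<^sub>R axis j 1" if "j \<notin> S" for j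
      using that assms(1)
      by (auto simp: vec_eq_iff matrix_axis_component block_on_def) (auto simp: axis_def)
    have Yj': "axis j 1 \<bullet> (Y *v x) = Y $ j $ j * x $ j" if "j \<notin> S" for j x
    proof -
      have "axis j 1 \<bullet> (Y *v x) = (\<Sum>l\<in>UNIV. Y $ j $ l * x $ l)"
        by (simp add: inner_axis' matrix_vector_mult_def)
      also have "\<dots> = (\<Sum>l\<in>UNIV. if l = j then Y $ j $ j * x $ j else 0)"
        using that assms(1) by (intro sum.cong) (auto simp: block_on_def)
      finally show ?thesis by simp
    qed
    have "mat_act Y A $ k $ j = (A *v axis k 1) \<bullet> (Y *v (A *v axis j 1))"
      by (simp add: bilinear_mat_act flip: bilinear_axis)
    then show ?thesis
      using that by (auto simp: Yj Yj' GL_on_axis[OF assms(2)] GL_on_axis_component[OF assms(2)] inner_axis)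
  qed
  then show ?thesis by (simp add: block_on_def)
qed

text \<open>
  A basis for the indices in \<open>S - {i}\<close> lifts to one for \<open>S\<close> that contains \<open>e\<^sub>i\<close>. Adding an integer
  multiple of \<open>e\<^sub>i\<close> to a basis vector moves its component along \<open>e\<^sub>i\<close> into \<open>[-1/2, 1/2]\<close>, so
  restoring the split-off square costs at most \<open>Y\<^sub>i\<^sub>i / 4\<close>.
\<close>

lemma lift_reduced_columns:
  assumes Y: "Y \<in> pos_def" "Y \<in> block_on S" and "i \<in> S" and A: "A \<in> GL_on (S - {i})"
  obtains X where "X \<in> GL_on S" "X *v axis i 1 = axis i 1"
    "\<And>j. j \<noteq> i \<Longrightarrow> qform Y (X *v axis j 1)
        \<le> qform (split_form Y i) (A *v axis j 1) + Y $ i $ i / 4"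
proof -
  have q: "Y $ i $ i > 0"
    using pos_defD(2)[OF Y(1), of "axis i 1"] by (simp add: qform_axis axis_eq_0_iff)
  note sym = pos_defD(1)[OF Y(1)]
  define x :: "real^'a" where
    "x = (\<chi> j. if j = i then 0 else - of_int (round (slope Y i \<bullet> (A *v axis j 1))))"
  have x0: "x $ j = 0" if "j \<notin> S" for j
  proof -
    have "slope Y i $ j = 0" using that Y(2) \<open>i \<in> S\<close> by (auto simp: slope_def block_on_def)
    then show ?thesis using that GL_on_axis[OF A, of j] by (simp add: x_def inner_axis)
  qed
  have T: "shear i x \<in> GL_on S"
    using x0 \<open>i \<in> S\<close> shear_int_GL[of x i] by (auto simp: GL_on_def shear_def) (auto simp: x_def)
  let ?X = "A ** shear i x"
  have col: "?X *v axis j 1 = A *v axis j 1 + x $ j *\<^sub>R axis i 1" for j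
    using GL_on_axis[OF A, of i]
    by (simp add: shear_mult_vec inner_axis matrix_vector_right_distrib matrix_vector_mult_scaleR
        flip: matrix_vector_mul_assoc)
  show thesis
  proof
    show "?X \<in> GL_on S" using GL_on_mult T A GL_on_mono[of "S - {i}" S] by blast
    show "?X *v axis i 1 = axis i 1"
      using col[of i] GL_on_axis[OF A, of i] by (simp add: x_def)
    show "qform Y (?X *v axis j 1) \<le> qform (split_form Y i) (A *v axis j 1) + Y $ i $ i / 4"
      if "j \<noteq> i" for j
    proof -
      let ?s = "slope Y i \<bullet> (A *v axis j 1)"
      have "\<bar>?s + x $ j\<bar> \<le> 1/2"
        using that of_int_round_abs_le[of ?s] by (simp add: x_def abs_minus_commute)
      then have "(?s + x $ j)\<^sup>2 \<le> (1/2)\<^sup>2"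
        by (metis abs_ge_zero power2_abs power_mono)
      then have "(?s + x $ j)\<^sup>2 * Y $ i $ i \<le> Y $ i $ i / 4"
        using q mult_right_mono[of _ "(1/2)\<^sup>2" "Y $ i $ i"] by (simp add: power_divide)
      moreover have "(A *v axis j 1) $ i = 0"
        using GL_on_axis_component[OF A, of i j] that by simp
      ultimately show ?thesis
        unfolding col using qform_split[OF sym, of i "A *v axis j 1" "x $ j"] q by simp
    qed
  qed
qed

lemma diagonal_entries_bounded:
  fixes Y :: "real^'m^'m"
  assumes "Y \<in> block_on {}" "0 < c" "\<And>j. c \<le> Y $ j $ j" "det Y \<le> C"
  shows "Y $ j $ j \<le> C / c ^ (CARD('m) - 1)" "c ^ CARD('m) \<le> det Y"
proof -
  have det: "det Y = (\<Prod>j\<in>UNIV. Y $ j $ j)"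
    using assms(1) by (intro det_diagonal) (auto simp: block_on_def)
  have "(\<Prod>j\<in>(UNIV::'m set). c) \<le> det Y"
    unfolding det by (intro prod_mono) (use assms in \<open>auto intro: less_imp_le\<close>)
  then show "c ^ CARD('m) \<le> det Y" by simp
  have "(\<Prod>k\<in>UNIV - {j}. c) \<le> (\<Prod>k\<in>UNIV - {j}. Y $ k $ k)"
    by (intro prod_mono) (use assms in \<open>auto intro: less_imp_le\<close>)
  then have "c ^ (CARD('m) - 1) * Y $ j $ j \<le> (\<Prod>k\<in>UNIV - {j}. Y $ k $ k) * Y $ j $ j"
    using assms(2) assms(3)[of j] by (intro mult_right_mono) (auto simp: card_Diff_singleton)
  also have "\<dots> = det Y"
    unfolding det by (subst (2) prod.remove[of _ j]) (auto simp: mult.commute)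
  finally show "Y $ j $ j \<le> C / c ^ (CARD('m) - 1)"
    using assms(2,4) by (simp add: field_simps)
qed

text \<open>
  Hermite's reduction by induction on the number \<open>k\<close> of indices not yet split off. The lower bound
  \<open>c\<close> concerns only vectors that occur in a lattice basis. This makes it unnecessary to extend a
  primitive vector to a basis: a vector \<open>b\<close> of nearly minimal length is chosen among the basis vectors.
  The complement of \<open>b\<close> satisfies the hypothesis with \<open>c / 4\<close>, since a shorter basis vector there would
  lift to a basis vector that is too short compared with \<open>b\<close>. Determinants do not change, and
  when no index is left the form is diagonal with entries bounded from below and bounded
  product. The same induction bounds the determinant from below. Both constants must be independent of the
  form, whence the order of the quantifiers.
\<close>

lemma reduction_on:
  fixes c C :: real
  assumes "0 < c"
  shows "\<exists>K. \<exists>\<epsilon>>0. \<forall>S. \<forall>Y :: real^'m^'m. card S = k \<longrightarrow> Y \<in> pos_def \<longrightarrow> Y \<in> block_on S \<longrightarrow>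
     (\<forall>A\<in>GL_on S. \<forall>j. c \<le> qform Y (A *v axis j 1)) \<longrightarrow> det Y \<le> C \<longrightarrow>
     (\<exists>A\<in>GL_on S. \<forall>j. qform Y (A *v axis j 1) \<le> K) \<and> \<epsilon> \<le> det Y"
  using assms
proof (induction k arbitrary: c)
  case 0
  show ?case
  proof (rule exI[of _ "C / c ^ (CARD('m) - 1)"], rule exI[of _ "c ^ CARD('m)"],
      intro conjI allI impI)
    show "0 < c ^ CARD('m)" using 0 by simp
    fix S and Y :: "real^'m^'m"
    assume S: "card S = 0" and Y: "Y \<in> pos_def" "Y \<in> block_on S" "det Y \<le> C"
      and c: "\<forall>A\<in>GL_on S. \<forall>j. c \<le> qform Y (A *v axis j 1)"
    have c': "c \<le> Y $ j $ j" for j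
      using c GL_on_one[of S] by (metis matrix_vector_mul_lid qform_axis)
    have "S = {}" using S by simp
    then show "\<exists>A\<in>GL_on S. \<forall>j. qform Y (A *v axis j 1) \<le> C / c ^ (CARD('m) - 1)"
      using diagonal_entries_bounded(1)[OF _ 0 c' Y(3)] Y(2) GL_on_one[of S]
      by (intro bexI[of _ "mat 1"]) (auto simp: qform_axis)
    show "c ^ CARD('m) \<le> det Y"
      using diagonal_entries_bounded(2)[OF _ 0 c' Y(3)] Y(2) \<open>S = {}\<close> by simp
  qed
next
  case (Suc k)
  have "0 < c / 4" using Suc.prems by simp
  from Suc.IH[OF this] obtain K \<epsilon> where \<epsilon>: "\<epsilon> > 0" and IH:
    "\<And>S. \<And>Y :: real^'m^'m. \<lbrakk>card S = k; Y \<in> pos_def; Y \<in> block_on S;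
       \<forall>A\<in>GL_on S. \<forall>j. c / 4 \<le> qform Y (A *v axis j 1); det Y \<le> C\<rbrakk> \<Longrightarrow>
     (\<exists>A\<in>GL_on S. \<forall>j. qform Y (A *v axis j 1) \<le> K) \<and> \<epsilon> \<le> det Y" by blast
  have "(\<exists>A\<in>GL_on S. \<forall>j. qform Y (A *v axis j 1) \<le> 2 * K) \<and> \<epsilon> \<le> det Y"
    if S: "card S = Suc k" and Y: "Y \<in> pos_def" "Y \<in> block_on S" "det Y \<le> C"
      and c: "\<forall>A\<in>GL_on S. \<forall>j. c \<le> qform Y (A *v axis j 1)" for S and Y :: "real^'m^'m"
  proof -
    define Q where "Q = {qform Y (A *v axis j 1) | A j. A \<in> GL_on S \<and> j \<in> S}"
    have "S \<noteq> {}" using S by auto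
    then have "Q \<noteq> {}" using GL_on_one[of S] unfolding Q_def by blast
    have lb: "c \<le> y" if "y \<in> Q" for y using that c by (auto simp: Q_def)
    then have bdd: "bdd_below Q" by (auto simp: bdd_below_def)
    have "c \<le> Inf Q" using \<open>Q \<noteq> {}\<close> lb by (intro cInf_greatest) auto
    \<comment> \<open>As \<open>Inf Q > 0\<close>, a basis vector within the factor 2 of the infimum exists; this
      avoids showing that the infimum is attained.\<close>
    then have "Inf Q < 2 * Inf Q" using Suc.prems by simp
    then obtain A i where A: "A \<in> GL_on S" "i \<in> S" "qform Y (A *v axis i 1) < 2 * Inf Q"
      using \<open>Q \<noteq> {}\<close> bdd cInf_less_iff[of Q "2 * Inf Q"] unfolding Q_def by blast
    have near: "qform Y (A *v axis i 1) \<le> 2 * qform Y (B *v axis j 1)"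
      if "B \<in> GL_on S" "j \<in> S" for B j
      using A(3) cInf_lower[OF _ bdd, of "qform Y (B *v axis j 1)"] that by (force simp: Q_def)
    define Y1 where "Y1 = mat_act Y A"
    define q where "q = Y1 $ i $ i"
    have invA: "invertible A" "A \<in> int_GL" using A(1) by (auto simp: GL_on_def int_GL_invertible)
    have Y1: "Y1 \<in> pos_def" "Y1 \<in> block_on S"
      unfolding Y1_def using mat_act_pos_def[OF Y(1) invA(1)] block_on_mat_act[OF Y(2) A(1)] by auto
    have qA: "q = qform Y (A *v axis i 1)"
      unfolding q_def Y1_def qform_axis[symmetric] qform_mat_act ..
    have q: "c \<le> q" unfolding qA using c A(1) by blast
    then have "q \<noteq> 0" using Suc.prems by simp
    define Y2 where "Y2 = split_form Y1 i"
    have Y2: "Y2 \<in> pos_def" "Y2 \<in> block_on (S - {i})" and detY2: "det Y2 = det Y"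
      using split_form_pos_def[OF Y1(1)] block_on_split_form[OF Y1(2) pos_defD(1)[OF Y1(1)]]
        \<open>q \<noteq> 0\<close> det_mat_act[of Y A] det_int_GL[OF invA(2)]
      by (auto simp: Y2_def q_def Y1_def)
    have Y2i: "qform Y2 (B *v axis i 1) = q" if "B \<in> GL_on (S - {i})" for B
      using GL_on_axis[OF that, of i] by (simp add: qform_axis Y2_def split_form_def q_def)
    have c2: "c / 4 \<le> qform Y2 (B *v axis j 1)" if B: "B \<in> GL_on (S - {i})" for B j
    proof (cases "j = i")
      case True
      then show ?thesis using Y2i[OF B] q Suc.prems by simp
    next
      case False
      obtain X where X: "X \<in> GL_on S" "\<And>j. j \<noteq> i \<Longrightarrow> qform Y1 (X *v axis j 1)
        \<le> qform Y2 (B *v axis j 1) + Y1 $ i $ i / 4"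
        using lift_reduced_columns[OF Y1 A(2) B] unfolding Y2_def by metis
      show ?thesis
      proof (cases "j \<in> S")
        case True
        \<comment> \<open>The lifted vector is a basis vector, so \<open>q / 2\<close> bounds it from below; removing the
          square of size at most \<open>q / 4\<close> leaves \<open>q / 4 \<ge> c / 4\<close>.\<close>
        have "q \<le> 2 * qform Y1 (X *v axis j 1)"
          unfolding qA Y1_def qform_mat_act matrix_vector_mul_assoc
          using near[OF GL_on_mult[OF A(1) X(1)] True] .
        then show ?thesis using X(2)[OF False] q unfolding q_def by linarith
      next
        case False
        then have "Y1 $ i $ j = 0"
          using Y1(2) \<open>j \<noteq> i\<close> by (auto simp: block_on_def)
        then have "qform Y2 (B *v axis j 1) = qform Y1 (axis j 1)"
          using GL_on_axis[OF B, of j] False \<open>j \<noteq> i\<close>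
          by (simp add: qform_axis Y2_def split_form_def)
        also have "\<dots> = qform Y (A *v axis j 1)" by (simp add: Y1_def qform_mat_act)
        finally have eq: "qform Y2 (B *v axis j 1) = qform Y (A *v axis j 1)" .
        have "c \<le> qform Y (A *v axis j 1)" using c A(1) by blast
        then show ?thesis unfolding eq using Suc.prems by simp
      qed
    qed
    have "card (S - {i}) = k" using S A(2) by simp
    from IH[OF this Y2] c2 Y(3) detY2 obtain B where B: "B \<in> GL_on (S - {i})"
      "\<And>j. qform Y2 (B *v axis j 1) \<le> K" and \<epsilon>Y: "\<epsilon> \<le> det Y" by auto
    \<comment> \<open>The bound for the smaller block also covers the split-off index, where the value is \<open>q\<close>.\<close>
    have qK: "q \<le> K" using B(2)[of i] Y2i[OF B(1)] by simp
    obtain X where X: "X \<in> GL_on S" "X *v axis i 1 = axis i 1" "\<And>j. j \<noteq> i \<Longrightarrow> qform Y1 (X *v axis j 1)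
        \<le> qform Y2 (B *v axis j 1) + q / 4"
      using lift_reduced_columns[OF Y1 A(2) B(1)] unfolding Y2_def q_def by metis
    have "qform Y ((A ** X) *v axis j 1) \<le> 2 * K" for j
    proof -
      have "qform Y1 (X *v axis j 1) \<le> 2 * K"
        using X(2) X(3)[of j] B(2)[of j] q qK Suc.prems qform_axis[of Y1 i]
        by (cases "j = i") (auto simp: q_def)
      then show ?thesis by (simp add: Y1_def qform_mat_act matrix_vector_mul_assoc)
    qed
    then show ?thesis using GL_on_mult[OF A(1) X(1)] \<epsilon>Y by blast
  qed
  then show ?case using \<epsilon> by blast
qed

text \<open>
  The case in which no index has been split off yet, with the bound \<open>c\<close> required on all nonzero integer
  vectors. The bound \<open>\<epsilon>\<close> keeps the reduced forms away from the boundary of the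
  cone of positive definite forms.
\<close>

lemma hermite_reduction:
  fixes c C :: real
  assumes "0 < c"
  obtains K \<epsilon> where "0 < \<epsilon>"
    "\<And>Y :: real^'m^'m. \<lbrakk>Y \<in> pos_def; \<And>a. a \<noteq> 0 \<Longrightarrow> (\<And>i. a $ i \<in> \<int>) \<Longrightarrow> c \<le> qform Y a; det Y \<le> C\<rbrakk> \<Longrightarrow>
     \<exists>A\<in>int_GL. (\<forall>j. qform Y (A *v axis j 1) \<le> K) \<and> \<epsilon> \<le> det Y"
proof -
  obtain K \<epsilon> where "\<epsilon> > 0" and *:
    "\<And>Y :: real^'m^'m. \<lbrakk>Y \<in> pos_def; Y \<in> block_on UNIV;
       \<forall>A\<in>GL_on UNIV. \<forall>j. c \<le> qform Y (A *v axis j 1); det Y \<le> C\<rbrakk> \<Longrightarrow>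
     (\<exists>A\<in>GL_on UNIV. \<forall>j. qform Y (A *v axis j 1) \<le> K) \<and> \<epsilon> \<le> det Y"
    using reduction_on[OF assms, of "CARD('m)" C, where 'm = 'm] by blast
  have GL: "GL_on UNIV = (int_GL :: (real^'m^'m) set)" by (auto simp: GL_on_def)
  show thesis
  proof (rule that[OF \<open>\<epsilon> > 0\<close>])
    fix Y :: "real^'m^'m"
    assume Y: "Y \<in> pos_def" "det Y \<le> C"
      and c: "\<And>a. a \<noteq> 0 \<Longrightarrow> (\<And>i. a $ i \<in> \<int>) \<Longrightarrow> c \<le> qform Y a"
    have "c \<le> qform Y (A *v axis j 1)" if "A \<in> int_GL" for A j
    proof (rule c)
      show "A *v axis j 1 \<noteq> 0"
        using that int_GL_invertible invertible_mult_vec_nonzero axis_eq_0_iff by (metis one_neq_zero)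
      show "(A *v axis j 1) $ i \<in> \<int>" for i
        using that by (simp add: matrix_vector_mul_component inner_axis int_GL_def int_mat_def)
    qed
    then show "\<exists>A\<in>int_GL. (\<forall>j. qform Y (A *v axis j 1) \<le> K) \<and> \<epsilon> \<le> det Y"
      using *[of Y] Y unfolding GL by (auto simp: block_on_def)
  qed
qed

section \<open>Characteristic polynomials with purely imaginary roots\<close>

lemma poly_det: "poly (det M) z = det (\<chi> i j. poly (M $ i $ j) z)"
  by (simp add: det_def poly_sum poly_prod)

lemma poly_charpoly:
  "poly (charpoly A) z = det (\<chi> i j. (if i = j then z else 0) - A $ i $ j)"
  unfolding charpoly_def poly_det by (rule arg_cong[where f = det]) (simp add: vec_eq_iff)

lemma charpoly_root_iff:
  fixes A :: "complex^'m^'m"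
  shows "poly (charpoly A) z = 0 \<longleftrightarrow> (\<exists>v. v \<noteq> 0 \<and> A *v v = z *s v)"
proof -
  let ?M = "\<chi> i j. (if i = j then z else 0) - A $ i $ j"
  have "?M *v v = z *s v - A *v v" for v
  proof -
    have "(?M *v v) $ i = z * v $ i - (A *v v) $ i" for i
      by (simp add: matrix_vector_mult_def left_diff_distrib sum_subtractf
          if_distrib[of "\<lambda>x. x * _"] cong: if_cong)
    then show ?thesis by (simp add: vec_eq_iff)
  qed
  then have "(\<forall>v. ?M *v v = 0 \<longrightarrow> v = 0) \<longleftrightarrow> (\<forall>v. A *v v = z *s v \<longrightarrow> v = 0)"
    by (simp add: eq_commute[of "z *s _"])
  then have "det ?M \<noteq> 0 \<longleftrightarrow> (\<forall>v. A *v v = z *s v \<longrightarrow> v = 0)"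
    by (simp add: invertible_det_nz[symmetric] invertible_left_inverse matrix_left_invertible_ker)
  then show ?thesis unfolding poly_charpoly by blast
qed

text \<open>
  In the Leibniz expansion a permutation other than the identity moves some index, whose factor is then
  constant. So only the diagonal term reaches the top degree.
\<close>

lemma charpoly_monic:
  fixes A :: "complex^'m^'m"
  shows "lead_coeff (charpoly A) = 1" "degree (charpoly A) = CARD('m)"
proof -
  define M :: "complex poly^'m^'m" where "M = (\<chi> i j. (if i = j then [:0, 1:] else 0) - [:A $ i $ j:])"
  define P where "P = {p. p permutes (UNIV :: 'm set)}"
  define t where "t p = of_int (sign p) * (\<Prod>i\<in>UNIV. M $ i $ p i)" for p
  have P: "finite P" "id \<in> P" by (auto simp: P_def permutes_id)
  have t_id: "t id = (\<Prod>i\<in>UNIV. [:- A $ i $ i, 1:])"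
    by (simp add: t_def M_def)
  have id: "degree (t id) = CARD('m)"
    unfolding t_id by (simp add: degree_prod_eq_sum_degree)
  have lead: "lead_coeff (t id) = 1"
    unfolding t_id lead_coeff_prod by simp
  have "degree (t p) < CARD('m)" if "p \<in> P - {id}" for p
  proof -
    have "\<exists>i. p i \<noteq> i" using that by (auto simp: fun_eq_iff)
    then obtain i where i: "p i \<noteq> i" by blast
    have "degree (t p) \<le> degree (\<Prod>i\<in>UNIV. M $ i $ p i)"
      unfolding t_def using degree_mult_le[of "of_int (sign p)" "\<Prod>i\<in>UNIV. M $ i $ p i"] by simp
    also have "\<dots> \<le> (\<Sum>i\<in>UNIV. degree (M $ i $ p i))"
      using degree_prod_sum_le[of UNIV "\<lambda>i. M $ i $ p i"] by (simp add: o_def)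
    also have "\<dots> < (\<Sum>i\<in>(UNIV::'m set). 1)"
      using i by (intro sum_strict_mono_ex1) (auto simp: M_def, metis)
    finally show ?thesis by simp
  qed
  then have R: "degree (sum t (P - {id})) < CARD('m)"
    by (intro degree_sum_less) auto
  have eq: "charpoly A = t id + sum t (P - {id})"
    using sum.remove[OF P, of t] by (simp add: charpoly_def det_def t_def P_def M_def)
  show "degree (charpoly A) = CARD('m)"
    unfolding eq using R id by (subst degree_add_eq_left) auto
  then show "lead_coeff (charpoly A) = 1"
    unfolding eq using R id lead by (simp add: coeff_eq_0)
qed

lemma cnj_det: "cnj (det M) = det (\<chi> i j. cnj (M $ i $ j))"
  by (simp add: det_def)

lemma charpoly_real_cnj:
  "poly (charpoly (map_matrix complex_of_real B)) (cnj z)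
    = cnj (poly (charpoly (map_matrix complex_of_real B)) z)"
  unfolding poly_charpoly cnj_det
  by (rule arg_cong[where f = det]) (simp add: vec_eq_iff map_matrix_def)

text \<open>
  The factor \<open>X\<^sup>2 + \<mu>\<^sup>2\<close>, in the form in which it occurs in \<open>symp_eig_def\<close>.
\<close>

definition imag_pair :: "real \<Rightarrow> complex poly" where
  "imag_pair \<mu> = [:- (\<i> * complex_of_real \<mu>), 1:] * [:\<i> * complex_of_real \<mu>, 1:]"

lemma poly_imag_pair: "poly (imag_pair \<mu>) z = z\<^sup>2 + (complex_of_real \<mu>)\<^sup>2"
  by (simp add: imag_pair_def algebra_simps power2_eq_square)

lemma imag_pair_nonzero: "imag_pair \<mu> \<noteq> 0"
  by (simp add: imag_pair_def)

lemma degree_imag_pair: "degree (imag_pair \<mu>) = 2"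
  by (simp add: imag_pair_def degree_mult_eq)

lemma prod_imag_pair_root_iff:
  "poly (\<Prod>\<mu>\<in>#N. imag_pair \<mu>) z = 0 \<longleftrightarrow> (\<exists>\<mu>\<in>#N. z = \<i> * \<mu> \<or> z = - (\<i> * \<mu>))"
proof -
  have "poly (imag_pair \<mu>) z = 0 \<longleftrightarrow> z = \<i> * \<mu> \<or> z = - (\<i> * \<mu>)" for \<mu>
    by (auto simp: imag_pair_def add_eq_0_iff square_eq_iff)
  then show ?thesis
    by (induction N) auto
qed

lemma degree_prod_imag_pair: "degree (\<Prod>\<mu>\<in>#N. imag_pair \<mu>) = 2 * size N"
  and prod_imag_pair_nonzero: "(\<Prod>\<mu>\<in>#N. imag_pair \<mu>) \<noteq> 0"
  by (induction N) (simp_all add: degree_mult_eq imag_pair_nonzero degree_imag_pair)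

text \<open>
  The roots \<open>\<plusminus>i\<mu>\<close> are split off together; both are roots because conjugation preserves the
  polynomial. The quotient is again invariant under conjugation, as \<open>X\<^sup>2 + \<mu>\<^sup>2\<close> is.
\<close>

lemma factor_imag_pairs:
  fixes p :: "complex poly"
  assumes "lead_coeff p = 1" "\<And>z. poly p (cnj z) = cnj (poly p z)"
    "\<And>z. poly p z = 0 \<Longrightarrow> Re z = 0 \<and> z \<noteq> 0"
  shows "\<exists>N. (\<forall>\<mu>\<in>#N. 0 < \<mu>) \<and> p = (\<Prod>\<mu>\<in>#N. imag_pair \<mu>)"
  using assms
proof (induction "degree p" arbitrary: p rule: less_induct)
  case less
  show ?case
  proof (cases "degree p = 0")
    case True
    then have "p = 1" using less.prems(1) by (auto elim!: degree_eq_zeroE)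
    then show ?thesis by (intro exI[of _ "{#}"]) simp
  next
    case False
    then obtain z where z: "poly p z = 0"
      using fundamental_theorem_of_algebra[of p] constant_degree[of p] by auto
    define \<mu> where "\<mu> = \<bar>Im z\<bar>"
    have z': "Re z = 0" "z \<noteq> 0" using less.prems(3)[OF z] by auto
    then have \<mu>: "\<mu> > 0" by (auto simp: \<mu>_def complex_eq_iff)
    have "poly p (cnj z) = 0" using z less.prems(2) by simp
    moreover have "{\<i> * complex_of_real \<mu>, - (\<i> * complex_of_real \<mu>)} = {z, cnj z}"
      using z' by (auto simp: \<mu>_def complex_eq_iff abs_if)
    ultimately have roots: "poly p (\<i> * \<mu>) = 0" "poly p (- (\<i> * \<mu>)) = 0"
      using z by (metis insertI1 insert_iff singletonD)+
    then obtain p1 where p1: "p = [:- (\<i> * \<mu>), 1:] * p1"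
      using poly_eq_0_iff_dvd by (metis dvdE)
    then have "poly p1 (- (\<i> * \<mu>)) = 0" using roots(2) \<mu> by simp
    then obtain q where q: "p1 = [:\<i> * \<mu>, 1:] * q"
      using poly_eq_0_iff_dvd[of p1 "- (\<i> * \<mu>)"] by (metis dvdE minus_minus)
    have p: "p = imag_pair \<mu> * q" by (simp only: p1 q imag_pair_def mult.assoc)
    have "q \<noteq> 0" using p less.prems(1) by auto
    have "degree q < degree p"
      unfolding p using \<open>q \<noteq> 0\<close> by (simp add: degree_mult_eq imag_pair_nonzero degree_imag_pair)
    moreover have "lead_coeff q = 1"
      using less.prems(1) unfolding p lead_coeff_mult by (simp add: imag_pair_def)
    moreover have "poly q (cnj z) = cnj (poly q z)" for z
    proof -
      have "poly (imag_pair \<mu> * map_poly cnj q) w = poly (imag_pair \<mu> * q) w" for w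
        using less.prems(2)[of "cnj w"] unfolding p by (auto simp: poly_imag_pair)
      then have "imag_pair \<mu> * map_poly cnj q = imag_pair \<mu> * q"
        by (metis poly_eq_poly_eq_iff ext)
      then have "map_poly cnj q = q" using imag_pair_nonzero by simp
      then show ?thesis by (metis complex_cnj_cnj poly_map_poly_cnj)
    qed
    moreover have "Re z = 0 \<and> z \<noteq> 0" if "poly q z = 0" for z
      using less.prems(3)[of z] that unfolding p by simp
    ultimately obtain N where "\<forall>\<mu>\<in>#N. 0 < \<mu>" "q = (\<Prod>\<mu>\<in>#N. imag_pair \<mu>)"
      using less.hyps by blast
    then show ?thesis using \<mu> p by (intro exI[of _ "add_mset \<mu> N"]) auto
  qed
qed

lemma imag_pairs_unique:
  assumes "(\<Prod>\<mu>\<in>#N. imag_pair \<mu>) = (\<Prod>\<mu>\<in>#N'. imag_pair \<mu>)" "\<forall>\<mu>\<in>#N. 0 < \<mu>" "\<forall>\<mu>\<in>#N'. 0 < \<mu>"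
  shows "N = N'"
  using assms
proof (induction N arbitrary: N')
  case empty
  then have "2 * size N' = 0" using degree_prod_imag_pair[of N'] by simp
  then show ?case by simp
next
  case (add \<mu> N)
  have "poly (\<Prod>\<mu>\<in>#N'. imag_pair \<mu>) (\<i> * \<mu>) = 0"
    unfolding add.prems(1)[symmetric] prod_imag_pair_root_iff by auto
  then obtain \<nu> where \<nu>: "\<nu> \<in># N'" "\<i> * complex_of_real \<mu> = \<i> * \<nu> \<or> \<i> * complex_of_real \<mu> = - (\<i> * \<nu>)"
    unfolding prod_imag_pair_root_iff by blast
  moreover have "\<mu> > 0" "\<nu> > 0" using add.prems(2,3) \<nu>(1) by auto
  ultimately have "\<mu> \<in># N'" by (auto simp: complex_eq_iff)
  then obtain N'' where N': "N' = add_mset \<mu> N''" by (metis multi_member_split)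
  have "N = N''"
    using add.prems imag_pair_nonzero[of \<mu>] by (intro add.IH) (auto simp: N')
  then show ?case using N' by simp
qed

text \<open>
  Both existence and uniqueness come from one reformulation: listing the index type in increasing order
  turns a monotone tuple into the sorted list of its values.
\<close>

lemma sorted_tuple_of_multiset:
  fixes N :: "real multiset"
  assumes "size N = CARD('n::{finite,linorder})"
  shows "\<exists>!d :: 'n \<Rightarrow> real. mono d \<and> image_mset d (mset_set UNIV) = N"
proof -
  define ks where "ks = sorted_list_of_set (UNIV :: 'n set)"
  have ks: "distinct ks" "sorted ks" "set ks = UNIV" "length ks = CARD('n)" "mset ks = mset_set UNIV"
    by (simp_all add: ks_def) (metis mset_sorted_list_of_multiset sorted_list_of_mset_set)
  define xs where "xs = sorted_list_of_multiset N"
  have iff: "mono d \<and> image_mset d (mset_set UNIV) = N \<longleftrightarrow> map d ks = xs" for d :: "'n \<Rightarrow> real"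
  proof
    assume d: "mono d \<and> image_mset d (mset_set UNIV) = N"
    then have "sorted (map d ks)" using ks(2)
      by (simp add: sorted_map monoD sorted_wrt_mono_rel[of _ "(\<le>)"])
    then have "map d ks = sort xs"
      using d ks(5) by (intro properties_for_sort[symmetric]) (auto simp: xs_def)
    then show "map d ks = xs" by (simp add: xs_def)
  next
    assume d: "map d ks = xs"
    have "mset (map d ks) = N" unfolding d by (simp add: xs_def)
    moreover have "mono d"
    proof (rule monoI)
      fix x y :: 'n assume "x \<le> y"
      obtain i j where ij: "i < length ks" "j < length ks" "x = ks ! i" "y = ks ! j"
        using ks(3) by (metis UNIV_I in_set_conv_nth)
      have "sorted (map d ks)" unfolding d by (simp add: xs_def)
      show "d x \<le> d y"
      proof (cases "i \<le> j")
        case True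
        then show ?thesis
          using sorted_nth_mono[OF \<open>sorted (map d ks)\<close>, of i j] ij by simp
      next
        case False
        then have "y \<le> x" using sorted_nth_mono[OF ks(2), of j i] ij by simp
        then show ?thesis using \<open>x \<le> y\<close> by simp
      qed
    qed
    ultimately show "mono d \<and> image_mset d (mset_set UNIV) = N" using ks(5) by simp
  qed
  have len: "length ks = length xs" using assms ks(4) by (simp add: xs_def flip: size_mset)
  have "\<exists>!d. map d ks = xs"
  proof (rule ex_ex1I)
    have "map (the \<circ> map_of (zip ks xs)) ks = xs"
      using len ks(1) by (intro nth_equalityI) (simp_all add: map_of_zip_nth)
    then show "\<exists>d. map d ks = xs" by blast
    show "d = d'" if "map d ks = xs" "map d' ks = xs" for d d'
      using that ks(3) by (metis UNIV_I ext map_eq_conv)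
  qed
  then show ?thesis unfolding iff .
qed

section \<open>Symplectic eigenvalues\<close>

lemma symp_J_component:
  "((symp_J :: real^('n::finite+'n)^('n+'n)) *v x) $ Inl a = x $ Inr a"
  "((symp_J :: real^('n::finite+'n)^('n+'n)) *v x) $ Inr a = - x $ Inl a"
  unfolding matrix_vector_mult_def symp_J_def
  by (simp_all add: sum.Plus[of UNIV UNIV, unfolded UNIV_Plus_UNIV]
      if_distrib[of "\<lambda>x. x * _"] sum_negf cong: if_cong)

lemma transpose_symp_J: "transpose symp_J = - symp_J"
proof -
  have "transpose symp_J $ i $ j = (- symp_J) $ i $ j" for i j :: "'a + 'a"
    by (auto simp: symp_J_def transpose_def split: sum.split)
  then show ?thesis by (simp only: vec_eq_iff) blast
qed

lemma symp_J_skew: "x \<bullet> (symp_J *v y) = - (y \<bullet> (symp_J *v x))"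
proof -
  have "x \<bullet> (symp_J *v y) = (transpose symp_J *v x) \<bullet> y"
    by (simp only: dot_lmul_matrix transpose_matrix_vector)
  then show ?thesis
    unfolding transpose_symp_J
    by (simp add: inner_commute matrix_vector_mult_def inner_vec_def sum_negf)
qed

lemma symp_J_eq_0: "symp_J *v x = 0 \<Longrightarrow> x = 0"
proof -
  assume *: "symp_J *v x = 0"
  have "x $ i = 0" for i
    using symp_J_component[of x] * by (cases i) (metis neg_equal_0_iff_equal zero_index)+
  then show ?thesis by (simp add: vec_eq_iff)
qed

lemma pos_def_invertible:
  assumes "Y \<in> pos_def" shows "invertible Y"
proof -
  have "x = 0" if "Y *v x = 0" for x
    using that pos_defD(2)[OF assms, of x] by (auto simp: qform_def)
  then show ?thesis by (auto simp: invertible_left_inverse matrix_left_invertible_ker)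
qed

lemma mult_inverse_symp_J:
  assumes "h \<in> pos_def"
  shows "h *v ((matrix_inv h ** symp_J) *v x) = symp_J *v x"
  using matrix_inv_cancel(1)[OF pos_def_invertible[OF assms]]
  by (metis matrix_mul_assoc matrix_mul_lid matrix_vector_mul_assoc)

lemma complex_eigenvector_iff:
  fixes B :: "real^'m^'m"
  shows "map_matrix complex_of_real B *v v = z *s v \<longleftrightarrow>
    B *v (\<chi> j. Re (v $ j)) = Re z *\<^sub>R (\<chi> j. Re (v $ j)) - Im z *\<^sub>R (\<chi> j. Im (v $ j)) \<and>
    B *v (\<chi> j. Im (v $ j)) = Im z *\<^sub>R (\<chi> j. Re (v $ j)) + Re z *\<^sub>R (\<chi> j. Im (v $ j))"
  unfolding vec_eq_iff complex_eq_iff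
  by (simp add: matrix_vector_mult_def map_matrix_def all_conj_distrib) (auto simp: algebra_simps)

text \<open>
  If \<open>h\<^sup>-\<^sup>1 J v = z v\<close>, then \<open>v\<^sup>* J v = z v\<^sup>* h v\<close>. The left side is purely imaginary because \<open>J\<close> is
  skew-symmetric, and \<open>v\<^sup>* h v > 0\<close>. The proof writes this out for the real and imaginary parts
  \<open>a\<close> and \<open>b\<close> of \<open>v\<close>.
\<close>

lemma charpoly_symplectic_roots:
  assumes h: "h \<in> pos_def"
    and root: "poly (charpoly (map_matrix complex_of_real (matrix_inv h ** symp_J))) z = 0"
  shows "Re z = 0 \<and> z \<noteq> 0"
proof -
  let ?B = "matrix_inv h ** symp_J"
  obtain v where v: "v \<noteq> 0" "map_matrix complex_of_real ?B *v v = z *s v"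
    using root charpoly_root_iff by blast
  define a b where "a = (\<chi> j. Re (v $ j))" and "b = (\<chi> j. Im (v $ j))"
  have ab: "?B *v a = Re z *\<^sub>R a - Im z *\<^sub>R b" "?B *v b = Im z *\<^sub>R a + Re z *\<^sub>R b"
    using v(2) unfolding complex_eigenvector_iff a_def b_def by auto
  have J: "symp_J *v a = Re z *\<^sub>R (h *v a) - Im z *\<^sub>R (h *v b)"
    "symp_J *v b = Im z *\<^sub>R (h *v a) + Re z *\<^sub>R (h *v b)"
    unfolding mult_inverse_symp_J[OF h, symmetric] ab
    by (simp_all add: matrix_vector_mult_scaleR algebra_simps matrix_vector_mult_diff_distrib)
  have "a \<noteq> 0 \<or> b \<noteq> 0" using v(1) by (auto simp: a_def b_def vec_eq_iff complex_eq_iff)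
  then have pos: "0 < qform h a + qform h b"
    using pos_defD(2,3)[OF h] by (meson add_nonneg_pos add_pos_nonneg)
  have "a \<bullet> (symp_J *v a) = 0" "b \<bullet> (symp_J *v b) = 0"
    using symp_J_skew[of a a] symp_J_skew[of b b] by auto
  then have "Re z * qform h a - Im z * (a \<bullet> (h *v b)) = 0" "Im z * (b \<bullet> (h *v a)) + Re z * qform h b = 0"
    unfolding J qform_def by (simp_all add: inner_diff_right inner_add_right)
  then have "Re z * (qform h a + qform h b) = 0"
    using sym_bilinear[OF pos_defD(1)[OF h], of a b] by (simp add: algebra_simps)
  then have "Re z = 0" using pos by simp
  moreover have "z \<noteq> 0"
    using J \<open>a \<noteq> 0 \<or> b \<noteq> 0\<close> symp_J_eq_0 by fastforce
  ultimately show ?thesis ..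
qed

text \<open>
  The description of \<open>symp_eig h\<close> by \<open>THE\<close> is satisfied by exactly one tuple: the characteristic
  polynomial determines the multiset of the numbers \<open>d\<^sub>k\<close>, and monotonicity determines their order.
\<close>

lemma symp_eig_spec:
  fixes h :: "real^('n::{finite,linorder}+'n)^('n+'n)"
  assumes h: "h \<in> pos_def"
  shows "0 < symp_eig h k" "mono (symp_eig h)"
    "charpoly (map_matrix complex_of_real (matrix_inv h ** symp_J))
      = (\<Prod>k\<in>UNIV. imag_pair (symp_eig h k))"
proof -
  let ?p = "charpoly (map_matrix complex_of_real (matrix_inv h ** symp_J))"
  obtain N where N: "\<forall>\<mu>\<in>#N. 0 < \<mu>" "?p = (\<Prod>\<mu>\<in>#N. imag_pair \<mu>)"
    using factor_imag_pairs[OF charpoly_monic(1) charpoly_real_cnj charpoly_symplectic_roots[OF h]] by blast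
  have size: "size N = CARD('n)"
    using charpoly_monic(2)[of "map_matrix complex_of_real (matrix_inv h ** symp_J)"]
      degree_prod_imag_pair[of N] unfolding N(2) by (simp add: card_Plus flip: UNIV_Plus_UNIV)
  have eq: "(\<forall>k. 0 < d k) \<and> mono d \<and> ?p = (\<Prod>k\<in>UNIV. imag_pair (d k)) \<longleftrightarrow>
     mono d \<and> image_mset d (mset_set UNIV) = N" (is "?L d \<longleftrightarrow> ?R d") for d :: "'n \<Rightarrow> real"
  proof -
    have prod: "(\<Prod>k\<in>UNIV. imag_pair (d k)) = (\<Prod>\<mu>\<in>#image_mset d (mset_set UNIV). imag_pair \<mu>)"
      by (simp add: prod_unfold_prod_mset image_mset.compositionality o_def)
    show ?thesis
    proof
      assume L: "?L d"
      then have "(\<Prod>\<mu>\<in>#image_mset d (mset_set UNIV). imag_pair \<mu>) = (\<Prod>\<mu>\<in>#N. imag_pair \<mu>)"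
        using N(2) prod by simp
      then have "image_mset d (mset_set UNIV) = N"
        by (rule imag_pairs_unique) (use L N(1) in auto)
      then show "?R d" using L by blast
    next
      assume R: "?R d"
      then have "\<forall>k. 0 < d k" using N(1) by (metis UNIV_I finite finite_set_mset_mset_set image_eqI set_image_mset)
      then show "?L d" using R N(2) prod by simp
    qed
  qed
  have "\<exists>!d :: 'n \<Rightarrow> real. ?L d" unfolding eq by (rule sorted_tuple_of_multiset[OF size])
  then have "?L (THE d. ?L d)" by (rule theI')
  then have "?L (symp_eig h)" unfolding symp_eig_def imag_pair_def .
  then show "0 < symp_eig h k" "mono (symp_eig h)" "?p = (\<Prod>k\<in>UNIV. imag_pair (symp_eig h k))"
    by auto
qed

lemma continuous_on_qform [continuous_intros]:
  "continuous_on S f \<Longrightarrow> continuous_on S g \<Longrightarrow> continuous_on S (\<lambda>x. qform (f x) (g x))"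
  unfolding qform_def matrix_vector_mult_def by (intro continuous_intros)

lemma pos_def_lower_bound:
  assumes "Y \<in> pos_def"
  obtains l where "0 < l" "\<And>x. l * (norm x)\<^sup>2 \<le> qform Y x"
proof -
  have "sphere (0::real^'a) 1 \<noteq> {}" by simp
  then obtain u where u: "norm u = 1" "\<And>x. norm x = 1 \<Longrightarrow> qform Y u \<le> qform Y x"
    using continuous_attains_inf[of "sphere (0::real^'a) 1" "qform Y"]
      continuous_on_qform[OF continuous_on_const continuous_on_id, of _ Y] by auto
  have "qform Y u * (norm x)\<^sup>2 \<le> qform Y x" for x
  proof (cases "x = 0")
    case True
    then show ?thesis by (simp add: qform_def)
  next
    case False
    have "(norm x)\<^sup>2 * qform Y u \<le> (norm x)\<^sup>2 * qform Y ((1 / norm x) *\<^sub>R x)"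
      using False by (intro mult_left_mono u(2)) auto
    also have "\<dots> = qform Y (norm x *\<^sub>R ((1 / norm x) *\<^sub>R x))" by (rule qform_scale[symmetric])
    also have "\<dots> = qform Y x" using False by simp
    finally show ?thesis by (simp add: mult.commute)
  qed
  moreover have "0 < qform Y u" using u(1) by (intro pos_defD(2)[OF assms]) auto
  ultimately show thesis using that by blast
qed

lemma compact_qform_sphere:
  assumes "Y \<in> pos_def" shows "compact {x. qform Y x = 1}"
proof -
  obtain l where l: "0 < l" "\<And>x. l * (norm x)\<^sup>2 \<le> qform Y x" using pos_def_lower_bound[OF assms] by blast
  have "norm x \<le> sqrt (1 / l)" if "qform Y x = 1" for x
    using l(2)[of x] l(1) that by (intro real_le_rsqrt) (simp add: field_simps)
  then have "bounded {x. qform Y x = 1}" by (auto simp: bounded_iff)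
  moreover have "closed {x. qform Y x = 1}"
    by (intro closed_Collect_eq continuous_intros)
  ultimately show ?thesis by (simp add: compact_eq_bounded_closed)
qed

text \<open>
  The largest eigenvalue \<open>d\<^sub>n(h)\<close> bounds the symplectic form with respect to the inner product given by
  \<open>h\<close>. Let \<open>\<mu>\<close> be the maximum of \<open>w\<^sup>T J x\<close> over \<open>h\<close>-unit vectors. At a maximiser \<open>(w, x)\<close> with \<open>\<mu> > 0\<close>, equality
  in the Cauchy-Schwarz inequality gives \<open>h\<^sup>-\<^sup>1 J x = \<mu> w\<close> and \<open>h\<^sup>-\<^sup>1 J w = -\<mu> x\<close>. Hence \<open>x - i w\<close> is an
  eigenvector of \<open>h\<^sup>-\<^sup>1 J\<close> for the eigenvalue \<open>i \<mu>\<close>, and \<open>\<mu>\<close> is one of the numbers \<open>d\<^sub>k(h)\<close>.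
\<close>

lemma symplectic_form_bound:
  fixes h :: "real^('n::{finite,linorder}+'n)^('n+'n)"
  assumes h: "h \<in> pos_def"
  shows "\<bar>a \<bullet> (symp_J *v b)\<bar> \<le> max_symp_eig h * sqrt (qform h a) * sqrt (qform h b)"
proof -
  define S where "S = {x. qform h x = 1}"
  define B where "B = matrix_inv h ** (symp_J :: real^('n+'n)^('n+'n))"
  have hB: "h *v (B *v x) = symp_J *v x" for x
    unfolding B_def by (rule mult_inverse_symp_J[OF h])
  have "compact (S \<times> S)" unfolding S_def by (intro compact_Times compact_qform_sphere h)
  have unit: "(1 / sqrt (qform h x)) *\<^sub>R x \<in> S" if "x \<noteq> 0" for x
    using pos_defD(2)[OF h that] by (simp add: S_def qform_scale power_divide)
  have "S \<noteq> {}" using unit[of "axis undefined 1"] by (auto simp: axis_eq_0_iff)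
  have "continuous_on (S \<times> S) (\<lambda>p. fst p \<bullet> (symp_J *v snd p))"
    unfolding matrix_vector_mult_def by (intro continuous_intros)
  from continuous_attains_sup[OF \<open>compact (S \<times> S)\<close> _ this] \<open>S \<noteq> {}\<close>
  obtain w x where wx: "w \<in> S" "x \<in> S"
    and sup: "\<And>a b. a \<in> S \<Longrightarrow> b \<in> S \<Longrightarrow> a \<bullet> (symp_J *v b) \<le> w \<bullet> (symp_J *v x)"
    by (auto simp: mem_Times_iff)
  define \<mu> where "\<mu> = w \<bullet> (symp_J *v x)"
  have bound: "a \<bullet> (symp_J *v b) \<le> \<mu> * (sqrt (qform h a) * sqrt (qform h b))" for a b
  proof (cases "a = 0 \<or> b = 0")
    case True
    then show ?thesis by (auto simp: qform_def)
  next
    case False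
    then have pos: "0 < qform h a" "0 < qform h b" using pos_defD(2)[OF h] by auto
    have "(1 / sqrt (qform h a)) *\<^sub>R a \<bullet> (symp_J *v ((1 / sqrt (qform h b)) *\<^sub>R b)) \<le> \<mu>"
      unfolding \<mu>_def using False by (intro sup unit) auto
    then show ?thesis using pos by (simp add: matrix_vector_mult_scaleR field_simps)
  qed
  have \<mu>_le: "\<mu> \<le> max_symp_eig h"
  proof (cases "\<mu> \<le> 0")
    case True
    then show ?thesis
      using symp_eig_spec(1)[OF h, of "Max UNIV"] by (simp add: max_symp_eig_def)
  next
    case False
    then have \<mu>: "\<mu> > 0" by simp
    have S1: "qform h w = 1" "qform h x = 1" using wx by (auto simp: S_def)
    \<comment> \<open>The operator \<open>B = h\<^sup>-\<^sup>1 J\<close> has norm at most \<open>\<mu>\<close>, because \<open>(B y)\<^sup>T h (B y) = (B y)\<^sup>T J y\<close>.\<close>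
    have small: "qform h (B *v y) \<le> \<mu>\<^sup>2" if "qform h y = 1" for y
    proof -
      have "qform h (B *v y) \<le> \<mu> * sqrt (qform h (B *v y))"
        using bound[of "B *v y" y] that by (simp add: qform_def hB)
      then have "sqrt (qform h (B *v y)) * sqrt (qform h (B *v y)) \<le> \<mu> * sqrt (qform h (B *v y))"
        using pos_defD(3)[OF h, of "B *v y"] by simp
      then have "sqrt (qform h (B *v y)) \<le> \<mu>"
        using \<mu> pos_defD(3)[OF h, of "B *v y"] by (metis mult_right_le_imp_le order_le_less real_sqrt_ge_zero)
      then show ?thesis using real_sqrt_le_iff sqrt_le_D by blast
    qed
    have "B *v x = \<mu> *\<^sub>R w"
    proof (rule ccontr)
      assume "B *v x \<noteq> \<mu> *\<^sub>R w"
      then have "0 < qform h (B *v x + (- \<mu>) *\<^sub>R w)" by (intro pos_defD(2)[OF h]) auto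
      also have "\<dots> = qform h (B *v x) - 2 * \<mu> * (w \<bullet> (h *v (B *v x))) + \<mu>\<^sup>2"
        unfolding qform_add[OF pos_defD(1)[OF h]] qform_scale
        using sym_bilinear[OF pos_defD(1)[OF h], of w "B *v x"] S1
        by (simp add: matrix_vector_mult_scaleR del: scaleR_minus_left)
      also have "\<dots> \<le> 0" using small[OF S1(2)] unfolding hB \<mu>_def[symmetric] by (simp add: power2_eq_square)
      finally show False by simp
    qed
    moreover have "B *v w = - \<mu> *\<^sub>R x"
    proof (rule ccontr)
      assume "B *v w \<noteq> - \<mu> *\<^sub>R x"
      then have "0 < qform h (B *v w + \<mu> *\<^sub>R x)"
        by (intro pos_defD(2)[OF h]) (auto simp: add_eq_0_iff2)
      also have "\<dots> = qform h (B *v w) + 2 * \<mu> * (x \<bullet> (h *v (B *v w))) + \<mu>\<^sup>2"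
        unfolding qform_add[OF pos_defD(1)[OF h]] qform_scale
        using sym_bilinear[OF pos_defD(1)[OF h], of x "B *v w"] S1
        by (simp add: matrix_vector_mult_scaleR)
      also have "\<dots> \<le> 0"
        using small[OF S1(1)] symp_J_skew[of x w] unfolding hB \<mu>_def[symmetric] by (simp add: power2_eq_square)
      finally show False by simp
    qed
    ultimately have B: "B *v x = \<mu> *\<^sub>R w" "B *v (- w) = \<mu> *\<^sub>R x"
      using matrix_vector_mult_scaleR[of B "- 1" w] by simp_all
    define v where "v = (\<chi> j. Complex (x $ j) (- w $ j))"
    have "(\<chi> j. Re (v $ j)) = x" "(\<chi> j. Im (v $ j)) = - w"
      by (simp_all add: v_def vec_eq_iff)
    then have "map_matrix complex_of_real B *v v = (\<i> * complex_of_real \<mu>) *s v"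
      unfolding complex_eigenvector_iff using B by simp
    moreover have "x \<noteq> 0" using S1(2) by (auto simp: qform_def)
    then have "v \<noteq> 0" by (auto simp: v_def vec_eq_iff complex_eq_iff)
    ultimately have "poly (charpoly (map_matrix complex_of_real B)) (\<i> * \<mu>) = 0"
      unfolding charpoly_root_iff by blast
    then have "\<exists>k. poly (imag_pair (symp_eig h k)) (\<i> * \<mu>) = 0"
      unfolding B_def symp_eig_spec(3)[OF h] by (simp add: poly_prod)
    then obtain k where "(\<i> * \<mu>)\<^sup>2 + (complex_of_real (symp_eig h k))\<^sup>2 = 0"
      unfolding poly_imag_pair by blast
    then have "complex_of_real ((symp_eig h k)\<^sup>2) = complex_of_real (\<mu>\<^sup>2)"
      by (simp add: power_mult_distrib add_eq_0_iff)
    then have "(symp_eig h k)\<^sup>2 = \<mu>\<^sup>2" by (simp only: of_real_eq_iff)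
    then have "\<mu> = symp_eig h k"
      using \<mu> symp_eig_spec(1)[OF h, of k] by (simp add: power2_eq_iff_nonneg)
    also have "\<dots> \<le> max_symp_eig h"
      unfolding max_symp_eig_def by (intro monoD[OF symp_eig_spec(2)[OF h]]) simp
    finally show ?thesis .
  qed
  have le: "a \<bullet> (symp_J *v b) \<le> max_symp_eig h * sqrt (qform h a) * sqrt (qform h b)" for a b
  proof -
    have "0 \<le> sqrt (qform h a) * sqrt (qform h b)"
      using pos_defD(3)[OF h] by simp
    then show ?thesis
      using bound[of a b] mult_right_mono[OF \<mu>_le, of "sqrt (qform h a) * sqrt (qform h b)"]
      by (simp add: mult.assoc)
  qed
  have "- (a \<bullet> (symp_J *v b)) \<le> max_symp_eig h * sqrt (qform h a) * sqrt (qform h b)"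
    using le[of b a] symp_J_skew[of b a] by (simp add: mult_ac)
  then show ?thesis using le[of a b] by (simp add: abs_le_iff)
qed

section \<open>The group \<open>\<Pi>\<^sub>r\<close>\<close>

definition weight :: "('n::finite \<Rightarrow> nat) \<Rightarrow> 'n + 'n \<Rightarrow> real" where
  "weight r i = (case i of Inl a \<Rightarrow> real (r a) | Inr a \<Rightarrow> 1)"

lemma delta_entry: "delta r $ i $ j = (if i = j then weight r i else 0)"
  by (simp add: delta_def weight_def)

lemma delta_mult_entry: "(delta r ** A) $ i $ j = weight r i * A $ i $ j"
  "(A ** delta r) $ i $ j = A $ i $ j * weight r j"
  by (simp_all add: matrix_matrix_mult_def delta_entry if_distrib[of "\<lambda>x. x * _"]
      if_distrib[of "\<lambda>x. _ * x"] cong: if_cong)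

lemma weight_ge_1: "(\<And>i. 0 < r i) \<Longrightarrow> 1 \<le> weight r i"
  by (auto simp: weight_def Suc_le_eq split: sum.split)

lemma invertible_delta:
  assumes "\<And>i. 0 < r i" shows "invertible (delta r)"
proof -
  have "(delta r ** (\<chi> i j. if i = j then 1 / weight r i else 0)) $ i $ j = mat 1 $ i $ j" for i j
    using weight_ge_1[of r i] assms by (auto simp: delta_mult_entry mat_def)
  then show ?thesis by (auto simp: invertible_right_inverse vec_eq_iff)
qed

lemma delta_int_mat: "delta r \<in> int_mat"
  by (auto simp: int_mat_def delta_def split: sum.split)

lemma symp_J_int_mat: "symp_J \<in> int_mat"
  by (auto simp: int_mat_def symp_J_def split: sum.split)

lemma mat_act_int_mat:
  assumes "Y \<in> int_mat" "A \<in> int_mat" shows "mat_act Y A \<in> int_mat"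
proof -
  have "transpose A \<in> int_mat" using assms(2) by (simp add: int_mat_def transpose_def)
  then show ?thesis unfolding mat_act_def using assms by (intro int_mat_mult)
qed

lemma G_grp_eq: "G_grp r = {delta r ** A ** matrix_inv (delta r) | A. A \<in> int_GL}"
  unfolding G_grp_def int_GL_eq by blast

lemma Sp_tilde_eq:
  "Sp_tilde = {\<beta>. invertible \<beta> \<and> (\<exists>\<epsilon>\<in>{1, - 1}. mat_act symp_J \<beta> = \<epsilon> *\<^sub>R symp_J)}"
  by (simp add: Sp_tilde_def mat_act_def)

lemma mat_act_scaleR: "mat_act (c *\<^sub>R Y) G = c *\<^sub>R mat_act Y G"
  by (simp add: mat_act_def matrix_matrix_mult_def vec_eq_iff sum_distrib_left sum_distrib_right mult_ac)

lemma matrix_inv_unique: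
  assumes "A ** B = mat 1" "B ** A = mat 1" shows "matrix_inv A = (B :: real^'m^'m)"
proof -
  have "invertible A" using assms by (auto simp: invertible_def)
  from matrix_inv_cancel(3)[OF this, of B] show ?thesis using assms by simp
qed

lemma Pi_grp_mult:
  assumes r: "\<And>i. 0 < r i" and "\<beta> \<in> Pi_grp r" "\<gamma> \<in> Pi_grp r" shows "\<beta> ** \<gamma> \<in> Pi_grp r"
proof -
  note inv = matrix_inv_cancel[OF invertible_delta, of r, OF r]
  obtain A B \<epsilon> \<epsilon>' where A: "A \<in> int_GL" "\<beta> = delta r ** A ** matrix_inv (delta r)"
    "B \<in> int_GL" "\<gamma> = delta r ** B ** matrix_inv (delta r)"
    and e: "\<epsilon> \<in> {1, -1}" "mat_act symp_J \<beta> = \<epsilon> *\<^sub>R symp_J"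
    "\<epsilon>' \<in> {1, -1}" "mat_act symp_J \<gamma> = \<epsilon>' *\<^sub>R symp_J"
    and i: "invertible \<beta>" "invertible \<gamma>"
    using assms(2,3) unfolding Pi_grp_def G_grp_eq Sp_tilde_eq by blast
  have "\<beta> ** \<gamma> = delta r ** (A ** B) ** matrix_inv (delta r)"
    unfolding A(2,4) by (simp add: matrix_mul_assoc inv(4))
  then have "\<beta> ** \<gamma> \<in> G_grp r" unfolding G_grp_eq using int_GL_mult A(1,3) by blast
  moreover have "mat_act symp_J (\<beta> ** \<gamma>) = (\<epsilon> * \<epsilon>') *\<^sub>R symp_J"
    by (simp add: e mat_act_scaleR flip: mat_act_mult)
  then have "\<beta> ** \<gamma> \<in> Sp_tilde"
    using e(1,3) i invertible_mult unfolding Sp_tilde_eq by auto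
  ultimately show ?thesis by (simp add: Pi_grp_def)
qed

lemma Pi_grp_invertible: "\<beta> \<in> Pi_grp r \<Longrightarrow> invertible \<beta>"
  by (simp add: Pi_grp_def Sp_tilde_def)

lemma Pi_grp_inverse:
  assumes r: "\<And>i. 0 < r i" and "\<beta> \<in> Pi_grp r" shows "matrix_inv \<beta> \<in> Pi_grp r"
proof -
  note inv = matrix_inv_cancel[OF invertible_delta, of r, OF r]
  obtain A \<epsilon> where A: "A \<in> int_GL" "\<beta> = delta r ** A ** matrix_inv (delta r)"
    and e: "\<epsilon> \<in> {1, -1}" "mat_act symp_J \<beta> = \<epsilon> *\<^sub>R symp_J"
    and i: "invertible \<beta>"
    using assms(2) unfolding Pi_grp_def G_grp_eq Sp_tilde_eq by blast
  note invA = matrix_inv_cancel[OF int_GL_invertible[OF A(1)]]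
  have "matrix_inv \<beta> = delta r ** matrix_inv A ** matrix_inv (delta r)"
    by (rule matrix_inv_unique) (simp_all add: A(2) matrix_mul_assoc inv invA)
  then have "matrix_inv \<beta> \<in> G_grp r" unfolding G_grp_eq using int_GL_inverse A(1) by blast
  moreover have "symp_J = mat_act (mat_act symp_J \<beta>) (matrix_inv \<beta>)"
    by (simp add: mat_act_mult matrix_inv_cancel[OF i])
  then have "symp_J = \<epsilon> *\<^sub>R mat_act symp_J (matrix_inv \<beta>)"
    unfolding e(2) mat_act_scaleR .
  then have "\<epsilon> *\<^sub>R symp_J = (\<epsilon> * \<epsilon>) *\<^sub>R mat_act symp_J (matrix_inv \<beta>)"
    by (metis scaleR_scaleR)
  then have "mat_act symp_J (matrix_inv \<beta>) = \<epsilon> *\<^sub>R symp_J" using e(1) by auto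
  then have "matrix_inv \<beta> \<in> Sp_tilde"
    using e(1) matrix_inv_cancel(5)[OF i] unfolding Sp_tilde_eq by blast
  ultimately show ?thesis by (simp add: Pi_grp_def)
qed

lemma metric_class_eqI:
  assumes r: "\<And>i. 0 < r i" and \<beta>: "\<beta> \<in> Pi_grp r"
  shows "metric_class r (mat_act h \<beta>, g) = metric_class r (h, g)"
proof -
  have "\<exists>\<gamma>'\<in>Pi_grp r. mat_act (mat_act h \<beta>) \<gamma> = mat_act h \<gamma>'" if "\<gamma> \<in> Pi_grp r" for \<gamma>
    using Pi_grp_mult[of r, OF r \<beta> that] by (auto simp: mat_act_mult)
  moreover have "\<exists>\<gamma>'\<in>Pi_grp r. mat_act h \<gamma> = mat_act (mat_act h \<beta>) \<gamma>'" if "\<gamma> \<in> Pi_grp r" for \<gamma>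
    using Pi_grp_mult[of r, OF r Pi_grp_inverse[of r, OF r \<beta>] that] matrix_inv_cancel(1)[OF Pi_grp_invertible[OF \<beta>]]
    by (intro bexI[of _ "matrix_inv \<beta> ** \<gamma>"]) (simp_all add: mat_act_mult matrix_mul_assoc)
  ultimately show ?thesis by (fastforce simp: metric_class_def)
qed

lemma mat_one_Pi_grp:
  assumes r: "\<And>i. 0 < r i" shows "mat 1 \<in> Pi_grp r"
proof -
  have "mat 1 = delta r ** mat 1 ** matrix_inv (delta r)"
    using matrix_inv_cancel(1)[OF invertible_delta, of r, OF r] by simp
  then have "mat 1 \<in> G_grp r" unfolding G_grp_eq using int_GL_one by blast
  moreover have "mat 1 \<in> Sp_tilde" by (auto simp: Sp_tilde_eq invertible_def)
  ultimately show ?thesis by (simp add: Pi_grp_def)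
qed

lemma metric_class_eqD:
  assumes r: "\<And>i. 0 < r i" and "metric_class r (h, g) = metric_class r (h', g')"
  shows "g' = g" "\<exists>\<beta>\<in>Pi_grp r. h' = mat_act h \<beta>"
proof -
  have "(h', g') \<in> metric_class r (h', g')"
    using mat_one_Pi_grp[of r, OF r] mat_act_one[of h'] by (force simp: metric_class_def)
  then have "(h', g') \<in> metric_class r (h, g)" using assms(2) by simp
  then show "g' = g" "\<exists>\<beta>\<in>Pi_grp r. h' = mat_act h \<beta>" by (auto simp: metric_class_def)
qed

section \<open>Compact sets of representatives\<close>

text \<open>
  Semidefiniteness and a lower bound on the determinant are closed conditions, and together they still
  force definiteness when \<open>\<epsilon> > 0\<close>; this is what makes the set compact inside the open cone.
\<close>

definition reduced_forms :: "real \<Rightarrow> real \<Rightarrow> (real^'m^'m) set" where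
  "reduced_forms K \<epsilon> = {Y. transpose Y = Y \<and> (\<forall>x. 0 \<le> qform Y x) \<and> (\<forall>j. Y $ j $ j \<le> K) \<and> \<epsilon> \<le> det Y}"

lemma continuous_on_det [continuous_intros]:
  fixes f :: "'a::topological_space \<Rightarrow> real^'m^'m"
  shows "continuous_on S f \<Longrightarrow> continuous_on S (\<lambda>x. det (f x))"
  unfolding det_def by (intro continuous_intros)

lemma norm_matrix_le_sum: "norm (Y :: real^'m^'n) \<le> (\<Sum>i\<in>UNIV. \<Sum>j\<in>UNIV. \<bar>Y $ i $ j\<bar>)"
proof -
  have "norm Y \<le> (\<Sum>i\<in>UNIV. norm (Y $ i))"
    unfolding norm_vec_def[of Y] by (rule L2_set_le_sum) simp
  also have "\<dots> \<le> (\<Sum>i\<in>UNIV. \<Sum>j\<in>UNIV. \<bar>Y $ i $ j\<bar>)"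
    by (intro sum_mono norm_le_l1_cart)
  finally show ?thesis .
qed

lemma compact_reduced_forms: "compact (reduced_forms K \<epsilon> :: (real^'m^'m) set)"
proof -
  have "\<bar>Y $ i $ j\<bar> \<le> K" if "Y \<in> reduced_forms K \<epsilon>" for Y :: "real^'m^'m" and i j
  proof -
    have Y: "transpose Y = Y" "\<And>x. 0 \<le> qform Y x" "Y $ i $ i \<le> K" "Y $ j $ j \<le> K"
      using that by (auto simp: reduced_forms_def)
    have "0 \<le> qform Y (axis i 1 + t *\<^sub>R axis j 1)" for t by (rule Y(2))
    then have "0 \<le> Y $ i $ i + 2 * (t * Y $ i $ j) + t\<^sup>2 * Y $ j $ j" for t
      by (simp add: qform_add[OF Y(1)] qform_scale qform_axis matrix_vector_mult_scaleR bilinear_axis)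
    from this[of 1] this[of "- 1"] show ?thesis using Y(3,4) by (simp add: abs_le_iff)
  qed
  then have "(\<Sum>i\<in>UNIV. \<Sum>j\<in>UNIV. \<bar>Y $ i $ j\<bar>) \<le> (\<Sum>i\<in>(UNIV::'m set). \<Sum>j\<in>(UNIV::'m set). K)"
    if "Y \<in> reduced_forms K \<epsilon>" for Y :: "real^'m^'m"
    using that by (intro sum_mono) auto
  then have "bounded (reduced_forms K \<epsilon> :: (real^'m^'m) set)"
    unfolding bounded_iff by (intro exI ballI order_trans[OF norm_matrix_le_sum])
  moreover have "closed (reduced_forms K \<epsilon> :: (real^'m^'m) set)"
    unfolding reduced_forms_def transpose_def
    by (intro closed_Collect_conj closed_Collect_all closed_Collect_eq closed_Collect_le continuous_intros)
  ultimately show ?thesis by (simp add: compact_eq_bounded_closed)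
qed

text \<open>
  A semidefinite form that vanishes at \<open>x \<noteq> 0\<close> takes a negative value at \<open>x + t Y x\<close> for a suitable small
  \<open>t < 0\<close>, unless \<open>Y x = 0\<close>; and \<open>Y x = 0\<close> is excluded by \<open>det Y \<noteq> 0\<close>.
\<close>

lemma reduced_forms_pos_def:
  assumes "0 < \<epsilon>" shows "reduced_forms K \<epsilon> \<subseteq> pos_def"
proof
  fix Y :: "real^'m^'m" assume "Y \<in> reduced_forms K \<epsilon>"
  then have Y: "transpose Y = Y" "\<And>x. 0 \<le> qform Y x" "det Y \<noteq> 0"
    using assms by (auto simp: reduced_forms_def)
  have "qform Y x \<noteq> 0" if "x \<noteq> 0" for x
  proof
    assume x: "qform Y x = 0"
    define y where "y = Y *v x"
    have "invertible Y" using Y(3) by (simp add: invertible_det_nz)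
    then have "y \<noteq> 0" unfolding y_def using that by (rule invertible_mult_vec_nonzero)
    have xy: "x \<bullet> (Y *v y) = (norm y)\<^sup>2"
      using sym_bilinear[OF Y(1), of x y] by (simp add: y_def power2_norm_eq_inner)
    \<comment> \<open>Nearly the minimiser of \<open>qform Y (x + t y) = 2 t |y|\<^sup>2 + t\<^sup>2 qform Y y\<close>; adding 1 avoids
      division by zero.\<close>
    define t where "t = - ((norm y)\<^sup>2 / (qform Y y + 1))"
    have b: "0 < qform Y y + 1" using Y(2)[of y] by simp
    have "0 \<le> qform Y (x + t *\<^sub>R y)" by (rule Y(2))
    also have "\<dots> = t * (2 * (norm y)\<^sup>2 + t * qform Y y)"
      using x by (simp add: qform_add[OF Y(1)] qform_scale matrix_vector_mult_scaleR xy
          power2_eq_square algebra_simps)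
    also have "\<dots> < 0"
    proof (rule mult_neg_pos)
      show "t < 0" using b \<open>y \<noteq> 0\<close> by (simp add: t_def)
      have "(norm y)\<^sup>2 * (qform Y y / (qform Y y + 1)) \<le> (norm y)\<^sup>2 * 1"
        using b by (intro mult_left_mono) (auto simp: field_simps)
      then have "- (norm y)\<^sup>2 \<le> t * qform Y y" by (simp add: t_def)
      moreover have "0 < (norm y)\<^sup>2" using \<open>y \<noteq> 0\<close> by simp
      ultimately show "0 < 2 * (norm y)\<^sup>2 + t * qform Y y" by linarith
    qed
    finally show False by simp
  qed
  then show "Y \<in> pos_def" using Y(1,2) by (auto simp: pos_def_def qform_def less_le)
qed

lemma continuous_on_mat_act [continuous_intros]:
  "continuous_on S f \<Longrightarrow> continuous_on S (\<lambda>x. mat_act (f x) G)"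
  unfolding mat_act_def matrix_matrix_mult_def by (intro continuous_intros)

lemma m_min_le_qform:
  assumes h: "h \<in> pos_def" and a: "a \<noteq> 0" "\<And>i. a $ i \<in> \<int>"
  shows "m_min r h \<le> qform (mat_act h (delta r)) a"
proof -
  define b where "b = (\<chi> i. \<lfloor>a $ i\<rfloor>)"
  have "(\<chi> i. real_of_int (b $ i)) = a" using a(2) by (simp add: b_def vec_eq_iff)
  moreover have "b \<noteq> 0"
  proof
    assume "b = 0"
    then have "a $ i = 0" for i using arg_cong[OF calculation, of "\<lambda>x. x $ i"] by simp
    then show False using a(1) by (simp add: vec_eq_iff)
  qed
  ultimately show ?thesis
    unfolding m_min_def qform_mat_act using pos_defD(3)[OF h]
    by (intro cInf_lower bdd_belowI[of _ 0]) blast+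
qed

text \<open>
  Reduction supplies \<open>A \<in> GL(2n, \<int>)\<close> such that \<open>h[P]\<close> is reduced for \<open>P = \<delta>\<^sub>r A\<close>. The matrix \<open>P\<close> need not come
  from a symplectic one, but the integral matrix \<open>P\<^sup>T J P\<close> has entries bounded by \<open>C\<^sub>2 K\<close>, so it lies in a
  finite set \<open>JJ\<close>. For each member of \<open>JJ\<close> one fixes \<open>P\<^sub>0 = \<delta>\<^sub>r A\<^sub>0\<close> realising it. When
  \<open>P\<^sup>T J P = P\<^sub>0\<^sup>T J P\<^sub>0\<close>, the quotient \<open>P P\<^sub>0\<^sup>-\<^sup>1\<close> preserves \<open>J\<close> and lies in \<open>\<Pi>\<^sub>r\<close>, and it moves \<open>h\<close> into the image
  of the reduced forms under \<open>P\<^sub>0\<^sup>-\<^sup>1\<close>. Finitely many compact images suffice.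
\<close>

lemma compact_representatives:
  fixes r :: "'n::{finite,linorder} \<Rightarrow> nat" and C\<^sub>0 C\<^sub>1 C\<^sub>2 :: real
  assumes r: "\<And>i. 0 < r i" and "0 < C\<^sub>0"
  obtains L where "compact L" "L \<subseteq> pos_def"
    "\<And>h. \<lbrakk>h \<in> pos_def; C\<^sub>0 \<le> m_min r h; det h \<le> C\<^sub>1; max_symp_eig h \<le> C\<^sub>2\<rbrakk> \<Longrightarrow>
       \<exists>\<beta>\<in>Pi_grp r. mat_act h \<beta> \<in> L"
proof -
  let ?D = "delta r" and ?J = "symp_J :: real^('n+'n)^('n+'n)"
  note inv = matrix_inv_cancel[OF invertible_delta, of r, OF r]
  obtain K \<epsilon> where \<epsilon>: "0 < \<epsilon>" and red:
    "\<And>Y :: real^('n+'n)^('n+'n). \<lbrakk>Y \<in> pos_def; \<And>a. a \<noteq> 0 \<Longrightarrow> (\<And>i. a $ i \<in> \<int>) \<Longrightarrow> C\<^sub>0 \<le> qform Y a;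
       det Y \<le> (det ?D)\<^sup>2 * C\<^sub>1\<rbrakk> \<Longrightarrow> \<exists>A\<in>int_GL. (\<forall>j. qform Y (A *v axis j 1) \<le> K) \<and> \<epsilon> \<le> det Y"
    using hermite_reduction[OF assms(2)] by metis
  define JJ where "JJ = {mat_act ?J (?D ** A) | A. A \<in> int_GL \<and>
      (\<forall>i j. \<bar>mat_act ?J (?D ** A) $ i $ j\<bar> \<le> C\<^sub>2 * K)}"
  have "JJ \<subseteq> {X. X \<in> int_mat \<and> (\<forall>i j. \<bar>X $ i $ j\<bar> \<le> C\<^sub>2 * K)}"
    by (auto simp: JJ_def int_GL_def intro!: mat_act_int_mat int_mat_mult symp_J_int_mat delta_int_mat)
  then have fin: "finite JJ" using finite_bounded_int_mat by (rule finite_subset)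
  have "\<forall>X\<in>JJ. \<exists>A. A \<in> int_GL \<and> mat_act ?J (?D ** A) = X" by (auto simp: JJ_def)
  then obtain A0 where A0: "\<And>X. X \<in> JJ \<Longrightarrow> A0 X \<in> int_GL"
     "\<And>X. X \<in> JJ \<Longrightarrow> mat_act ?J (?D ** A0 X) = X" by metis
  define L where "L = (\<Union>X\<in>JJ. (\<lambda>Y. mat_act Y (matrix_inv (A0 X) ** matrix_inv ?D)) ` reduced_forms K \<epsilon>)"
  show thesis
  proof
    show "compact L"
      unfolding L_def using fin
      by (intro compact_UN compact_continuous_image compact_reduced_forms continuous_intros) auto
    show "L \<subseteq> pos_def"
      using reduced_forms_pos_def[OF \<epsilon>, of K] matrix_inv_cancel(5)[OF int_GL_invertible[OF A0(1)]] inv(5)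
      by (auto simp: L_def intro!: mat_act_pos_def invertible_mult)
    fix h :: "real^('n+'n)^('n+'n)"
    assume h: "h \<in> pos_def" "C\<^sub>0 \<le> m_min r h" "det h \<le> C\<^sub>1" "max_symp_eig h \<le> C\<^sub>2"
    have "mat_act h ?D \<in> pos_def"
      using mat_act_pos_def[OF h(1) invertible_delta[of r, OF r]] .
    moreover have "C\<^sub>0 \<le> qform (mat_act h ?D) a" if "a \<noteq> 0" "\<And>i. a $ i \<in> \<int>" for a
      using m_min_le_qform[OF h(1) that] h(2) by (rule order_trans[rotated])
    moreover have "det (mat_act h ?D) \<le> (det ?D)\<^sup>2 * C\<^sub>1"
      unfolding det_mat_act using h(3) by (intro mult_left_mono) auto
    ultimately obtain A where A: "A \<in> int_GL" "\<And>j. qform (mat_act h ?D) (A *v axis j 1) \<le> K"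
      "\<epsilon> \<le> det (mat_act h ?D)" using red by metis
    let ?P = "?D ** A"
    have qK: "qform h (?P *v axis j 1) \<le> K" for j
      using A(2)[of j] by (simp add: qform_mat_act matrix_vector_mul_assoc)
    have "\<bar>mat_act ?J ?P $ i $ j\<bar> \<le> C\<^sub>2 * K" for i j
    proof -
      let ?q = "\<lambda>j. sqrt (qform h (?P *v axis j 1))"
      have q: "0 \<le> ?q j" "?q j \<le> sqrt K" for j
        using qK[of j] pos_defD(3)[OF h(1)] by auto
      have "0 \<le> K" using qK[of i] pos_defD(3)[OF h(1)] order_trans by blast
      have d: "0 < max_symp_eig h"
        unfolding max_symp_eig_def by (rule symp_eig_spec(1)[OF h(1)])
      have "\<bar>mat_act ?J ?P $ i $ j\<bar> = \<bar>(?P *v axis i 1) \<bullet> (?J *v (?P *v axis j 1))\<bar>"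
        by (simp only: bilinear_axis[symmetric] bilinear_mat_act)
      also have "\<dots> \<le> max_symp_eig h * ?q i * ?q j"
        by (rule symplectic_form_bound[OF h(1)])
      also have "\<dots> \<le> C\<^sub>2 * sqrt K * sqrt K"
        using q h(4) d \<open>0 \<le> K\<close> by (intro mult_mono) auto
      finally show ?thesis using \<open>0 \<le> K\<close> by (simp add: mult.assoc)
    qed
    then have X: "mat_act ?J ?P \<in> JJ" using A(1) by (auto simp: JJ_def)
    define B where "B = A0 (mat_act ?J ?P)"
    have B: "B \<in> int_GL" "mat_act ?J (?D ** B) = mat_act ?J ?P"
      using A0[OF X] by (simp_all add: B_def)
    note invB = matrix_inv_cancel[OF int_GL_invertible[OF B(1)]]
    let ?b = "?D ** (A ** matrix_inv B) ** matrix_inv ?D"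
    have b: "?b = ?P ** (matrix_inv B ** matrix_inv ?D)" by (simp add: matrix_mul_assoc)
    have AB: "A ** matrix_inv B \<in> int_GL" using A(1) B(1) int_GL_mult int_GL_inverse by blast
    then have "?b \<in> G_grp r" unfolding G_grp_eq by blast
    moreover have "mat_act ?J ?b = mat_act ?J (?D ** B ** (matrix_inv B ** matrix_inv ?D))"
      unfolding b by (metis mat_act_mult B(2))
    then have "mat_act ?J ?b = ?J" by (simp add: matrix_mul_assoc invB inv)
    moreover have "invertible ?b"
      using invertible_mult invertible_delta[of r, OF r] inv(5) int_GL_invertible[OF AB] by blast
    ultimately have "?b \<in> Pi_grp r" by (auto simp: Pi_grp_def Sp_tilde_eq)
    moreover have "mat_act h ?P \<in> reduced_forms K \<epsilon>"
    proof -
      have pd: "mat_act h ?P \<in> pos_def"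
        using mat_act_pos_def[OF h(1)] invertible_mult invertible_delta[of r, OF r] int_GL_invertible[OF A(1)]
        by blast
      have "det (mat_act h ?P) = det (mat_act h ?D)"
        using det_int_GL[OF A(1)] by (simp add: det_mat_act flip: mat_act_mult)
      then show ?thesis
        using pos_defD(1,3)[OF pd] A(3) qK
        by (simp add: reduced_forms_def flip: qform_axis) (simp add: qform_mat_act)
    qed
    then have "mat_act h ?b \<in> L"
      unfolding L_def b using X B_def by (auto simp flip: mat_act_mult)
    ultimately show "\<exists>\<beta>\<in>Pi_grp r. mat_act h \<beta> \<in> L" by blast
  qed
qed

section \<open>Images of compact sets are closed\<close>

lemma norm_matrix_vector_le: "norm ((A :: real^'m^'n) *v x) \<le> real CARD('n) * norm A * norm x"
proof -
  have "norm (A *v x) \<le> (\<Sum>i\<in>UNIV. \<bar>(A *v x) $ i\<bar>)" by (rule norm_le_l1_cart)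
  also have "\<dots> \<le> (\<Sum>i\<in>(UNIV::'n set). norm A * norm x)"
  proof (rule sum_mono)
    fix i
    have "\<bar>(A *v x) $ i\<bar> \<le> norm (A $ i) * norm x"
      unfolding matrix_vector_mul_component by (rule Cauchy_Schwarz_ineq2)
    also have "\<dots> \<le> norm A * norm x" by (intro mult_right_mono Finite_Cartesian_Product.norm_nth_le) auto
    finally show "\<bar>(A *v x) $ i\<bar> \<le> norm A * norm x" .
  qed
  finally show ?thesis by simp
qed

lemma eventually_pos_def_lower_bound:
  fixes h :: "real^'m^'m"
  assumes h: "h \<in> pos_def" and lim: "X \<longlonglongrightarrow> h"
  obtains c where "0 < c" "\<forall>\<^sub>F k in sequentially. \<forall>x. c * (norm x)\<^sup>2 \<le> qform (X k) x"
proof -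
  obtain l where l: "0 < l" "\<And>x. l * (norm x)\<^sup>2 \<le> qform h x" using pos_def_lower_bound[OF h] by blast
  define m where "m = real CARD('m)"
  have m: "0 < m" by (simp add: m_def)
  have "\<forall>\<^sub>F k in sequentially. dist (X k) h < l / (2 * m)"
    using lim m l(1) by (intro tendstoD) auto
  then have "\<forall>\<^sub>F k in sequentially. \<forall>x. l / 2 * (norm x)\<^sup>2 \<le> qform (X k) x"
  proof eventually_elim
    case (elim k)
    show ?case
    proof
      fix x
      have "\<bar>x \<bullet> ((X k - h) *v x)\<bar> \<le> norm x * norm ((X k - h) *v x)"
        by (rule Cauchy_Schwarz_ineq2)
      also have "\<dots> \<le> norm x * (m * norm (X k - h) * norm x)"
        unfolding m_def by (intro mult_left_mono norm_matrix_vector_le) auto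
      also have "\<dots> = m * norm (X k - h) * (norm x)\<^sup>2" by (simp add: power2_eq_square)
      also have "\<dots> \<le> l / 2 * (norm x)\<^sup>2"
        using elim m by (intro mult_right_mono) (auto simp: dist_norm field_simps)
      finally have "\<bar>x \<bullet> ((X k - h) *v x)\<bar> \<le> l / 2 * (norm x)\<^sup>2" .
      moreover have "x \<bullet> ((X k - h) *v x) = qform (X k) x - qform h x"
        by (simp add: qform_def matrix_vector_mult_diff_rdistrib inner_diff_right)
      ultimately show "l / 2 * (norm x)\<^sup>2 \<le> qform (X k) x" using l(2)[of x] by linarith
    qed
  qed
  then show thesis using l(1) that[of "l / 2"] by simp
qed

text \<open>
  If \<open>\<beta> = \<delta>\<^sub>r A \<delta>\<^sub>r\<^sup>-\<^sup>1\<close>, then \<open>A\<^sub>i\<^sub>j\<close> is \<open>\<beta>\<^sub>i\<^sub>j\<close> times the quotient of two diagonal entries of \<open>\<delta>\<^sub>r\<close>, so the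
  integral matrix \<open>A\<close> is bounded.
\<close>

lemma finite_bounded_Pi_grp:
  assumes r: "\<And>i. 0 < r i"
  shows "finite {\<beta> \<in> Pi_grp r. \<forall>i j. \<bar>\<beta> $ i $ j\<bar> \<le> b}"
proof (rule finite_subset)
  let ?D = "delta r"
  note inv = matrix_inv_cancel[OF invertible_delta, of r, OF r]
  let ?W = "\<Sum>j\<in>UNIV. weight r j"
  have w: "1 \<le> weight r j" for j using weight_ge_1[of r j] r by blast
  show "finite ((\<lambda>A. ?D ** A ** matrix_inv ?D) ` {A. A \<in> int_mat \<and> (\<forall>i j. \<bar>A $ i $ j\<bar> \<le> b * ?W)})"
    by (intro finite_imageI finite_bounded_int_mat)
  show "{\<beta> \<in> Pi_grp r. \<forall>i j. \<bar>\<beta> $ i $ j\<bar> \<le> b}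
     \<subseteq> (\<lambda>A. ?D ** A ** matrix_inv ?D) ` {A. A \<in> int_mat \<and> (\<forall>i j. \<bar>A $ i $ j\<bar> \<le> b * ?W)}"
  proof
    fix \<beta> assume "\<beta> \<in> {\<beta> \<in> Pi_grp r. \<forall>i j. \<bar>\<beta> $ i $ j\<bar> \<le> b}"
    then have b: "\<And>i j. \<bar>\<beta> $ i $ j\<bar> \<le> b" and "\<beta> \<in> G_grp r" by (auto simp: Pi_grp_def)
    then obtain A where A: "A \<in> int_GL" "\<beta> = ?D ** A ** matrix_inv ?D" unfolding G_grp_eq by blast
    have eq: "?D ** A = \<beta> ** ?D" by (simp add: A(2) inv(4))
    have "\<bar>A $ i $ j\<bar> \<le> b * ?W" for i j
    proof -
      have "weight r j \<le> ?W" using w by (intro member_le_sum) (auto intro: order_trans[of 0 1])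
      have "\<bar>A $ i $ j\<bar> \<le> weight r i * \<bar>A $ i $ j\<bar>" using w[of i] mult_right_mono[of 1 "weight r i"] by simp
      also have "\<dots> = \<bar>\<beta> $ i $ j\<bar> * weight r j"
        using arg_cong[OF eq, of "\<lambda>X. \<bar>X $ i $ j\<bar>"] w[of i] w[of j]
        by (simp add: delta_mult_entry abs_mult)
      also have "\<dots> \<le> b * ?W"
        using b[of i j] w[of j] \<open>weight r j \<le> ?W\<close> by (intro mult_mono) auto
      finally show ?thesis .
    qed
    then show "\<beta> \<in> (\<lambda>A. ?D ** A ** matrix_inv ?D) ` {A. A \<in> int_mat \<and> (\<forall>i j. \<bar>A $ i $ j\<bar> \<le> b * ?W)}"
      using A by (auto simp: int_GL_def)
  qed
qed

text \<open>
  The action is proper. If points converging to \<open>(h, g)\<close> are moved into \<open>L\<close> by \<open>\<beta>\<^sub>k \<in> \<Pi>\<^sub>r\<close>, the columns of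
  \<open>\<beta>\<^sub>k\<close> are bounded, because \<open>h\<^sub>k[\<beta>\<^sub>k]\<close> is bounded and \<open>h\<^sub>k\<close> is bounded from below for large \<open>k\<close>. By discreteness
  \<open>\<beta>\<^sub>k\<close> eventually lies in a finite set, and finitely many closed conditions pass to the limit.
\<close>

lemma closedin_image_compact:
  assumes r: "\<And>i. 0 < r i" and L: "compact L" "L \<subseteq> metric_params"
  shows "closedin (moduli_space r) (metric_class r ` L)"
proof -
  let ?S = "metric_params :: ((real^('a + 'a)^('a + 'a)) \<times> real) set"
  define C where "C = {x \<in> ?S. metric_class r x \<in> metric_class r ` L}"
  have "x \<in> C" if x: "x \<in> ?S" "x \<in> closure C" for x
  proof -
    obtain h g where hg: "x = (h, g)" by fastforce
    have h: "h \<in> pos_def" using x(1) hg by (simp add: metric_params_def)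
    obtain X where X: "\<And>k. X k \<in> C" "X \<longlonglongrightarrow> x" using x(2) closure_sequential by blast
    have "\<exists>\<beta>\<in>Pi_grp r. (mat_act (fst (X k)) \<beta>, snd (X k)) \<in> L" for k
    proof -
      obtain h' g' where "(h', g') \<in> L" "metric_class r (fst (X k), snd (X k)) = metric_class r (h', g')"
        using X(1)[of k] by (auto simp: C_def)
      then show ?thesis using metric_class_eqD[of r, OF r] by metis
    qed
    then obtain \<beta> where \<beta>: "\<And>k. \<beta> k \<in> Pi_grp r" "\<And>k. (mat_act (fst (X k)) (\<beta> k), snd (X k)) \<in> L"
      by metis
    obtain R where R: "\<And>p. p \<in> L \<Longrightarrow> norm p \<le> R"
      using compact_imp_bounded[OF L(1)] by (auto simp: bounded_iff)
    have "(\<lambda>k. fst (X k)) \<longlonglongrightarrow> h" using tendsto_fst[OF X(2)] hg by simp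
    then obtain c where c: "0 < c"
      "\<forall>\<^sub>F k in sequentially. \<forall>x. c * (norm x)\<^sup>2 \<le> qform (fst (X k)) x"
      using eventually_pos_def_lower_bound[OF h] by blast
    define F where "F = {\<beta> \<in> Pi_grp r. \<forall>i j. \<bar>\<beta> $ i $ j\<bar> \<le> sqrt (R / c)}"
    have "finite F" unfolding F_def by (rule finite_bounded_Pi_grp[of r, OF r])
    have "\<forall>\<^sub>F k in sequentially. \<beta> k \<in> F"
      using c(2)
    proof eventually_elim
      case (elim k)
      have "\<bar>\<beta> k $ i $ j\<bar> \<le> sqrt (R / c)" for i j
      proof -
        let ?Y = "mat_act (fst (X k)) (\<beta> k)"
        have "c * (norm (\<beta> k *v axis j 1))\<^sup>2 \<le> ?Y $ j $ j"
          using elim by (simp add: qform_mat_act flip: qform_axis)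
        also have "\<dots> \<le> norm ?Y"
          using Finite_Cartesian_Product.norm_nth_le[of "?Y $ j" j] Finite_Cartesian_Product.norm_nth_le[of ?Y j] by simp
        also have "\<dots> \<le> R" using R[OF \<beta>(2)[of k]] norm_fst_le[of ?Y "snd (X k)"] by linarith
        finally have "norm (\<beta> k *v axis j 1) \<le> sqrt (R / c)"
          using c(1) by (intro real_le_rsqrt) (simp add: field_simps)
        moreover have "\<bar>\<beta> k $ i $ j\<bar> \<le> norm (\<beta> k *v axis j 1)"
          using Finite_Cartesian_Product.norm_nth_le[of "\<beta> k *v axis j 1" i] by (simp add: matrix_axis_component)
        ultimately show ?thesis by linarith
      qed
      then show ?case using \<beta>(1) by (simp add: F_def)
    qed
    define T where "T = (\<Union>\<gamma>\<in>F. (\<lambda>p. (mat_act (fst p) \<gamma>, snd p)) -` L)"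
    have "closed T"
      unfolding T_def using \<open>finite F\<close>
      by (intro closed_UN ballI closed_vimage compact_imp_closed[OF L(1)] continuous_intros) auto
    moreover have "\<forall>\<^sub>F k in sequentially. X k \<in> T"
      using \<open>\<forall>\<^sub>F k in sequentially. \<beta> k \<in> F\<close> by eventually_elim (use \<beta>(2) in \<open>auto simp: T_def\<close>)
    ultimately have "x \<in> T" by (rule Lim_in_closed_set) (use X(2) in auto)
    then obtain \<gamma> where "\<gamma> \<in> Pi_grp r" "(mat_act h \<gamma>, g) \<in> L"
      by (auto simp: T_def F_def hg)
    then have "metric_class r x \<in> metric_class r ` L"
      using metric_class_eqI[of r \<gamma> h g, OF r] hg
      by (intro image_eqI[of _ _ "(mat_act h \<gamma>, g)"]) simp_all
    then show ?thesis using x(1) by (simp add: C_def)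
  qed
  moreover have "C \<subseteq> ?S" by (auto simp: C_def)
  ultimately have "C = ?S \<inter> closure C" using closure_subset[of C] by blast
  then have "closedin (top_of_set ?S) C" by (metis closed_closure closedin_closed)
  moreover have "metric_class r ` L \<subseteq> topspace (moduli_space r)"
    using L(2) by (auto simp: topspace_moduli_space)
  ultimately show ?thesis
    using quotient_map_moduli_space[of r] unfolding quotient_map_closedin C_def by simp
qed

theorem corollary3p14:
  fixes r :: "'n::{finite,linorder} \<Rightarrow> nat"
    and M :: "((real^('n + 'n)^('n + 'n)) \<times> real) set set"
    and C\<^sub>0 C\<^sub>1 C\<^sub>2 :: real
    and I :: "real set"
  assumes "r \<in> div_chains"
    and "M \<subseteq> topspace (moduli_space r)"
    and "0 < C\<^sub>0" and "0 < C\<^sub>1" and "0 < C\<^sub>2"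
    and "compact I" and "is_interval I" and "I \<subseteq> {0<..}"
    and "\<And>h g. \<lbrakk>(h, g) \<in> metric_params; metric_class r (h, g) \<in> M\<rbrakk> \<Longrightarrow>
           g \<in> I \<and> m_min r h \<ge> C\<^sub>0 \<and> det h \<le> C\<^sub>1 \<and> max_symp_eig h \<le> C\<^sub>2"
  shows "compactin (moduli_space r) (moduli_space r closure_of M)"
proof -
  have r: "0 < r i" for i using assms(1) by (simp add: div_chains_def)
  obtain L where L: "compact L" "L \<subseteq> pos_def"
    "\<And>h. \<lbrakk>h \<in> pos_def; C\<^sub>0 \<le> m_min r h; det h \<le> C\<^sub>1; max_symp_eig h \<le> C\<^sub>2\<rbrakk> \<Longrightarrow>
       \<exists>\<beta>\<in>Pi_grp r. mat_act h \<beta> \<in> L"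
    using compact_representatives[of r C\<^sub>0 C\<^sub>1 C\<^sub>2, OF r assms(3)] by blast
  have LI: "compact (L \<times> I)" "L \<times> I \<subseteq> metric_params"
    using L(1,2) assms(6,8) by (auto simp: metric_params_def intro: compact_Times)
  have "M \<subseteq> metric_class r ` (L \<times> I)"
  proof
    fix m assume "m \<in> M"
    then obtain h g where hg: "(h, g) \<in> metric_params" "m = metric_class r (h, g)"
      using assms(2) by (auto simp: topspace_moduli_space)
    then have b: "g \<in> I" "m_min r h \<ge> C\<^sub>0" "det h \<le> C\<^sub>1" "max_symp_eig h \<le> C\<^sub>2"
      using assms(9)[of h g] \<open>m \<in> M\<close> by auto
    obtain \<beta> where "\<beta> \<in> Pi_grp r" "mat_act h \<beta> \<in> L"
      using L(3)[of h] b hg(1) by (auto simp: metric_params_def)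
    then show "m \<in> metric_class r ` (L \<times> I)"
      using metric_class_eqI[of r \<beta> h g, OF r] b(1) hg(2) by (intro image_eqI[of _ _ "(mat_act h \<beta>, g)"]) simp_all
  qed
  moreover have "closedin (moduli_space r) (metric_class r ` (L \<times> I))"
    by (rule closedin_image_compact[of r, OF r LI])
  ultimately have "moduli_space r closure_of M \<subseteq> metric_class r ` (L \<times> I)"
    by (rule closure_of_minimal)
  moreover have "compactin (moduli_space r) (metric_class r ` (L \<times> I))"
  proof (rule image_compactin)
    show "compactin (top_of_set metric_params) (L \<times> I)"
      using LI by (simp add: compactin_subtopology)
    show "continuous_map (top_of_set metric_params) (moduli_space r) (metric_class r)"
      using quotient_imp_continuous_map quotient_map_moduli_space by blast
  qed
  ultimately show ?thesis by (metis closed_compactin closedin_closure_of)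
qed

end
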